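(* Let $\mu\ge 0$, let $m\ge 0$ be an integer and $\phi_\nu=\frac{2\nu\pi}{2m+1}$ for $0\le\nu\le 2m$. Then for every $f\in L^2(W_\mu;B^2)$ and $(x,y)\in B^2$, the partial sum $S_{2m}^\mu(f;x,y)=\sum_{k=0}^{2m}\operatorname{proj}_k^\mu f(x,y)$ satisfies $$S_{2m}^\mu(f;x,y)=\frac{1}{2m+1}\sum_{\nu=0}^{2m}a_\mu\int_{-1}^1\mathcal R_{\phi_\nu}^\mu(f;t)\,\Phi_{2m}^\mu(\phi_\nu,t;x,y)\,dt,$$ where $$\Phi_{2m}^\mu(\xi,t;x,y)=\sum_{k=0}^{2m}\frac{k+\mu+1/2}{\mu+1/2}\,C_k^{\mu+1/2}(t)\,D_k^{\mu+1/2}(\xi;x,y).$$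
   Context: $B^2$ is the closed unit disk in $\mathbb R^2$; $W_\mu(x,y)=(1-x^2-y^2)^{\mu-1/2}$ on $B^2$; $a_\mu=(\mu+1/2)/\pi=1/\int_{B^2}W_\mu$; $\langle P,Q\rangle_\mu=a_\mu\int_{B^2}PQW_\mu\,dx\,dy$. $\mathcal V_k^2(W_\mu)$ is the space of polynomials in two variables of degree $k$ (together with $0$) that are orthogonal under $\langle\cdot,\cdot\rangle_\mu$ to all polynomials of total degree $<k$, and $\operatorname{proj}_k^\mu$ is the orthogonal projection of $L^2(W_\mu;B^2)$ onto $\mathcal V_k^2(W_\mu)$ (identified with its polynomial representative). Attenuated Radon projection: $$\mathcal R_\theta^\mu(f;t)=\int_{-\sqrt{1-t^2}}^{\sqrt{1-t^2}}f(t\cos\theta-s\sin\theta,\,t\sin\theta+s\cos\theta)\,(1-s^2-t^2)^{\mu-1/2}\,ds,\qquad -1\le t\le 1$$ (defined for a.e. $t$ for $f\in L^2(W_\mu;B^2)$). $(a)_k=a(a+1)\cdots(a+k-1)$. $C_k^\lambda$ is the Gegenbauer polynomial of degree $k$, orthogonal for $(1-s^2)^{\lambda-1/2}$ on $[-1,1]$, with $C_k^\lambda(1)=(2\lambda)_k/k!$. $p_l^{(\alpha,\beta)}$ is the Jacobi polynomial of degree $l$ with positive leading coefficient, orthonormal for the weight $(1-t)^\alpha(1+t)^\beta$ normalized to have integral $1$ on $[-1,1]$. Orthonormal basis of $\mathcal V_k^2(W_\mu)$: in polar coordinates $x=r\cos\phi$, $y=r\sin\phi$, $$P_{l,\varepsilon}^k(x,y)=h_{l,k}\,p_l^{(\mu-1/2,\,k-2l)}(2r^2-1)\,r^{k-2l}S_{k-2l,\varepsilon}(\phi),$$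 where $S_{j,0}(\phi)=\cos j\phi$, $S_{j,1}(\phi)=\sin j\phi$, $0\le 2l\le k$ if $\varepsilon=0$, $0\le 2l\le k-1$ if $\varepsilon=1$, and $$h_{l,k}^2=\frac1{d_{l,k}}\,\frac{\Gamma(k-2l+\mu+3/2)}{\Gamma(\mu+3/2)\Gamma(k-2l+1)},\quad h_{l,k}>0,\qquad d_{l,k}=\tfrac12\ (2l<k),\quad d_{l,k}=1\ (2l=k).$$ $$\lambda_{l,k}^\mu=\frac{l!\,(k-l)!\,(k-l+\mu+\frac12)}{(\mu+\frac12)_l\,(\mu+\frac32)_{k-l}\,(k+\mu+\frac12)},\qquad D_k^{\mu+1/2}(\xi;x,y)=\sum_{l,\varepsilon}\lambda_{l,k}^\mu\,P_{l,\varepsilon}^k(\cos\xi,\sin\xi)\,P_{l,\varepsilon}^k(x,y)$$ (sum over all admissible pairs $(l,\varepsilon)$). *)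

theory Defs
  imports "HOL-Analysis.Analysis" "HOL-Computational_Algebra.Polynomial"
begin

abbreviation B2 :: "(real \<times> real) set" where
  "B2 \<equiv> cball (0, 0) 1"

definition W :: "real \<Rightarrow> real \<times> real \<Rightarrow> real" where
  "W \<mu> = (\<lambda>(x, y). (1 - x\<^sup>2 - y\<^sup>2) powr (\<mu> - 1/2))"

definition a_const :: "real \<Rightarrow> real" where
  "a_const \<mu> = (\<mu> + 1/2) / pi"

definition disc_inner :: "real \<Rightarrow> (real \<times> real \<Rightarrow> real) \<Rightarrow> (real \<times> real \<Rightarrow> real) \<Rightarrow> real" where
  "disc_inner \<mu> P Q = a_const \<mu> * (LINT z:B2|lebesgue. P z * Q z * W \<mu> z)"

text \<open>Elements of the weighted $L^2$ space are represented by functions on the plane,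
  whose values outside the disc are never used.\<close>

definition L2_disc :: "real \<Rightarrow> (real \<times> real \<Rightarrow> real) set" where
  "L2_disc \<mu> = {f. f \<in> borel_measurable (lebesgue_on B2) \<and>
                   set_integrable lebesgue B2 (\<lambda>z. (f z)\<^sup>2 * W \<mu> z)}"

text \<open>Real polynomials in two variables are identified with their polynomial functions.\<close>

definition poly2_le :: "nat \<Rightarrow> (real \<times> real \<Rightarrow> real) set" where
  "poly2_le n = {P. \<exists>c :: nat \<Rightarrow> nat \<Rightarrow> real. \<forall>x y.
                   P (x, y) = (\<Sum>i\<le>n. \<Sum>j\<le>n - i. c i j * x ^ i * y ^ j)}"

definition has_degree2 :: "(real \<times> real \<Rightarrow> real) \<Rightarrow> nat \<Rightarrow> bool" where
  "has_degree2 P k \<longleftrightarrow> P \<in> poly2_le k \<and> (\<forall>n<k. P \<notin> poly2_le n)"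

definition V :: "real \<Rightarrow> nat \<Rightarrow> (real \<times> real \<Rightarrow> real) set" where
  "V \<mu> k = {P. (P = (\<lambda>_. 0) \<or> has_degree2 P k) \<and>
               (\<forall>n<k. \<forall>Q\<in>poly2_le n. disc_inner \<mu> P Q = 0)}"

definition proj :: "real \<Rightarrow> nat \<Rightarrow> (real \<times> real \<Rightarrow> real) \<Rightarrow> real \<times> real \<Rightarrow> real" where
  "proj \<mu> k f = (THE P. P \<in> V \<mu> k \<and> (\<forall>Q\<in>V \<mu> k. disc_inner \<mu> (\<lambda>z. f z - P z) Q = 0))"

definition partial_sum :: "real \<Rightarrow> nat \<Rightarrow> (real \<times> real \<Rightarrow> real) \<Rightarrow> real \<times> real \<Rightarrow> real" where
  "partial_sum \<mu> n f z = (\<Sum>k\<le>n. proj \<mu> k f z)"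

definition radon :: "real \<Rightarrow> real \<Rightarrow> (real \<times> real \<Rightarrow> real) \<Rightarrow> real \<Rightarrow> real" where
  "radon \<mu> \<theta> f t =
     (LINT s:{- sqrt (1 - t\<^sup>2)..sqrt (1 - t\<^sup>2)}|lebesgue.
        f (t * cos \<theta> - s * sin \<theta>, t * sin \<theta> + s * cos \<theta>) *
        (1 - s\<^sup>2 - t\<^sup>2) powr (\<mu> - 1/2))"

definition gegenbauer :: "real \<Rightarrow> nat \<Rightarrow> real poly" where
  "gegenbauer \<gamma> k = (THE p. degree p = k \<and>
     (\<forall>q. degree q < k \<longrightarrow>
        (LINT s:{-1..1}|lebesgue. poly p s * poly q s * (1 - s\<^sup>2) powr (\<gamma> - 1/2)) = 0) \<and>
     poly p 1 = pochhammer (2 * \<gamma>) k / fact k)"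

definition jacobi_weight :: "real \<Rightarrow> real \<Rightarrow> real \<Rightarrow> real" where
  "jacobi_weight \<alpha> \<beta> t = (1 - t) powr \<alpha> * (1 + t) powr \<beta>"

definition jacobi_inner :: "real \<Rightarrow> real \<Rightarrow> real poly \<Rightarrow> real poly \<Rightarrow> real" where
  "jacobi_inner \<alpha> \<beta> p q =
     (LINT t:{-1..1}|lebesgue. poly p t * poly q t * jacobi_weight \<alpha> \<beta> t) /
     (LINT t:{-1..1}|lebesgue. jacobi_weight \<alpha> \<beta> t)"

definition jacobi_orthonormal :: "real \<Rightarrow> real \<Rightarrow> nat \<Rightarrow> real poly" where
  "jacobi_orthonormal \<alpha> \<beta> l = (THE p. degree p = l \<and> lead_coeff p > 0 \<and>
     (\<forall>q. degree q < l \<longrightarrow> jacobi_inner \<alpha> \<beta> p q = 0) \<and>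
     jacobi_inner \<alpha> \<beta> p p = 1)"

definition S_trig :: "nat \<Rightarrow> nat \<Rightarrow> real \<Rightarrow> real" where
  "S_trig j \<epsilon> \<phi> = (if \<epsilon> = 0 then cos (real j * \<phi>) else sin (real j * \<phi>))"

definition d_const :: "nat \<Rightarrow> nat \<Rightarrow> real" where
  "d_const l k = (if 2 * l < k then 1/2 else 1)"

definition h_const :: "real \<Rightarrow> nat \<Rightarrow> nat \<Rightarrow> real" where
  "h_const \<mu> l k = sqrt (1 / d_const l k *
     (Gamma (real (k - 2 * l) + \<mu> + 3/2) / (Gamma (\<mu> + 3/2) * Gamma (real (k - 2 * l) + 1))))"

text \<open>The admissible indices; the condition $2l \le k - 1$ for $\varepsilon = 1$ is written
  without subtraction, so that it is unsatisfiable for $k = 0$.\<close>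

definition basis_index :: "nat \<Rightarrow> (nat \<times> nat) set" where
  "basis_index k = {(l, \<epsilon>). (\<epsilon> = 0 \<and> 2 * l \<le> k) \<or> (\<epsilon> = 1 \<and> 2 * l + 1 \<le> k)}"

text \<open>The polar angle is the principal argument; any other choice gives the same value,
  also at the origin, where the power of $r$ vanishes unless $k = 2l$.\<close>

definition basis_fun :: "real \<Rightarrow> nat \<Rightarrow> nat \<Rightarrow> nat \<Rightarrow> real \<times> real \<Rightarrow> real" where
  "basis_fun \<mu> k l \<epsilon> = (\<lambda>(x, y).
     let r = sqrt (x\<^sup>2 + y\<^sup>2); \<phi> = Arg (Complex x y)
     in h_const \<mu> l k *
        poly (jacobi_orthonormal (\<mu> - 1/2) (real (k - 2 * l)) l) (2 * r\<^sup>2 - 1) *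
        r ^ (k - 2 * l) * S_trig (k - 2 * l) \<epsilon> \<phi>)"

definition lambda_const :: "real \<Rightarrow> nat \<Rightarrow> nat \<Rightarrow> real" where
  "lambda_const \<mu> l k =
     fact l * fact (k - l) * (real (k - l) + \<mu> + 1/2) /
     (pochhammer (\<mu> + 1/2) l * pochhammer (\<mu> + 3/2) (k - l) * (real k + \<mu> + 1/2))"

text \<open>The first parameter is $\mu$, although the notation $D_k^{\mu+1/2}$ carries the
  superscript $\mu + 1/2$.\<close>

definition D_kernel :: "real \<Rightarrow> nat \<Rightarrow> real \<Rightarrow> real \<times> real \<Rightarrow> real" where
  "D_kernel \<mu> k \<xi> z =
     (\<Sum>(l, \<epsilon>)\<in>basis_index k.
        lambda_const \<mu> l k * basis_fun \<mu> k l \<epsilon> (cos \<xi>, sin \<xi>) * basis_fun \<mu> k l \<epsilon> z)"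

definition Phi :: "real \<Rightarrow> nat \<Rightarrow> real \<Rightarrow> real \<Rightarrow> real \<times> real \<Rightarrow> real" where
  "Phi \<mu> n \<xi> t z =
     (\<Sum>k\<le>n. (real k + \<mu> + 1/2) / (\<mu> + 1/2) * poly (gegenbauer (\<mu> + 1/2) k) t *
             D_kernel \<mu> k \<xi> z)"

end

theory Submission
  imports Defs
begin

text \<open>
  Slicing the disc by lines orthogonal to the direction \<open>\<xi>\<close> turns \<open>\<integral> radon \<mu> \<xi> f t * g t dt\<close> into the inner
  product of \<open>f\<close> with the ridge polynomial \<open>g (x cos \<xi> + y sin \<xi>)\<close>. For \<open>Q \<in> V \<mu> k\<close> the sliced
  polynomial is \<open>(1 - t\<^sup>2) powr \<mu>\<close> times a multiple of the Gegenbauer polynomial \<open>C\<close> of degree \<open>k\<close>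
  and parameter \<open>\<mu> + 1/2\<close>, so the ridge of \<open>C\<close> reproduces, up to the factor
  \<open>(\<mu> + 1/2) / (k + \<mu> + 1/2)\<close>, the value of \<open>Q\<close> at \<open>(cos \<xi>, sin \<xi>)\<close>. On the unit circle a basis
  function is a constant times \<open>cos\<close> or \<open>sin\<close> of a frequency \<open>j \<le> k \<le> 2 m\<close> with \<open>j\<close> of the parity
  of \<open>k\<close>, and these are orthogonal on the \<open>2 m + 1\<close> equidistant nodes: a sum of two frequencies is
  even and at most \<open>4 m\<close>, so \<open>2 m + 1\<close> divides it only if it vanishes. The numbers \<open>lambda_const\<close> are
  exactly the reciprocals of the squared norms on the nodes. Hence \<open>Q\<close> is recovered from its values
  at the nodes by means of \<open>D_kernel\<close>, and the two facts together give a finite-rank kernel whose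
  operator is the identity on \<open>V \<mu> k\<close>, i.e. the projection.
\<close>

section \<open>Integration over the disc\<close>

text \<open>For fixed \<open>k\<close> each frequency \<open>k - 2 * l\<close> comes from a single
  \<open>l\<close>, so on the unit circle the basis functions become, up to constants, distinct
  members of the trigonometric system, and an element of \<open>V \<mu> k\<close> is determined by
  its boundary values. This is why samples on the circle can suffice. The function \<open>f\<close>,
  being only square integrable, is never sampled: it enters through its inner products with ridge
  polynomials.

  The squared boundary amplitude of a basis function is \<open>h_const\<close> squared divided by
  \<open>beta_norm\<close>, the mean square of its angular factor is \<open>d_const\<close>, and
  \<open>lambda_const\<close> inverts the product of the two; the number of nodes cancels against
  the factor in front of the sum.

  Since \<open>gegenbauer\<close>, \<open>jacobi_orthonormal\<close> and \<open>proj\<close> are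
  definite descriptions, each calls for existence and uniqueness. For the polynomials, existence is
  an explicit hypergeometric sum and uniqueness is positivity of the weight; for the projection, the
  finite-rank formula itself supplies existence.\<close>

definition rot :: "real \<Rightarrow> real \<times> real \<Rightarrow> real \<times> real" where
  "rot \<theta> = (\<lambda>(x, y). (x * cos \<theta> - y * sin \<theta>, x * sin \<theta> + y * cos \<theta>))"

lemma borel_measurable_pairI [measurable (raw)]:
  "f \<in> M \<rightarrow>\<^sub>M borel \<Longrightarrow> g \<in> M \<rightarrow>\<^sub>M borel \<Longrightarrow> (\<lambda>x. (f x :: real, g x :: real)) \<in> M \<rightarrow>\<^sub>M borel"
  by (subst borel_prod[symmetric]) measurable

lemma borel_measurable_fst_real [measurable]: "fst \<in> (borel :: (real \<times> real) measure) \<rightarrow>\<^sub>M borel"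
  by (subst borel_prod[symmetric]) measurable

lemma borel_measurable_snd_real [measurable]: "snd \<in> (borel :: (real \<times> real) measure) \<rightarrow>\<^sub>M borel"
  by (subst borel_prod[symmetric]) measurable

lemma measurable_lborel_pair:
  "measurable (lborel \<Otimes>\<^sub>M lborel) N = measurable (borel :: (real \<times> real) measure) N"
  by (rule measurable_cong_sets) (metis lborel_prod sets_lborel, simp)

text \<open>Fubini with the inner integral over \<open>x\<close>: for fixed \<open>y\<close> the
  shear is a translation, which preserves Lebesgue measure on the line.\<close>

lemma shear_distr:
  "distr lborel borel (\<lambda>(x, y). (x + a * y, y)) = (lborel :: (real \<times> real) measure)"
proof (rule measure_eqI)
  fix A :: "(real \<times> real) set"
  assume "A \<in> sets (distr lborel borel (\<lambda>(x, y). (x + a * y, y)))"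
  then have A[measurable]: "A \<in> sets borel" by simp
  have m: "(\<lambda>(x, y). (x + a * y, y)) \<in> (borel :: (real \<times> real) measure) \<rightarrow>\<^sub>M borel"
    unfolding case_prod_unfold by measurable
  have f1: "(\<lambda>z. indicator A (fst z + a * snd z, snd z) :: ennreal) \<in> borel_measurable (lborel \<Otimes>\<^sub>M lborel)"
    and f2: "(\<lambda>z. indicator A z :: ennreal) \<in> borel_measurable (lborel \<Otimes>\<^sub>M lborel)"
    unfolding measurable_lborel_pair by measurable
  have "emeasure (distr lborel borel (\<lambda>(x, y). (x + a * y, y))) A
      = (\<integral>\<^sup>+z. indicator A z \<partial>distr lborel borel (\<lambda>(x, y). (x + a * y, y)))"
    by simp
  also have "\<dots> = (\<integral>\<^sup>+z. indicator A (fst z + a * snd z, snd z) \<partial>lborel)"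
    using m by (subst nn_integral_distr) (auto simp: case_prod_unfold)
  also have "\<dots> = (\<integral>\<^sup>+z. indicator A (fst z + a * snd z, snd z) \<partial>(lborel \<Otimes>\<^sub>M lborel))"
    by (simp only: lborel_prod)
  also have "\<dots> = (\<integral>\<^sup>+y. \<integral>\<^sup>+x. indicator A (x + a * y, y) \<partial>lborel \<partial>lborel)"
    using lborel_pair.nn_integral_snd[OF f1] by simp
  also have "\<dots> = (\<integral>\<^sup>+y. \<integral>\<^sup>+x. indicator A (x, y) \<partial>lborel \<partial>lborel)"
  proof (rule nn_integral_cong)
    fix y :: real
    have [measurable]: "(\<lambda>x. indicator A (x, y) :: ennreal) \<in> borel_measurable borel"
      by measurable
    show "(\<integral>\<^sup>+x. indicator A (x + a * y, y) \<partial>lborel) = (\<integral>\<^sup>+x. indicator A (x, y) \<partial>lborel)"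
      using nn_integral_real_affine[of "\<lambda>x. indicator A (x, y)" 1 "a * y"]
      by (simp add: add.commute)
  qed
  also have "\<dots> = (\<integral>\<^sup>+z. indicator A z \<partial>(lborel \<Otimes>\<^sub>M lborel))"
    using lborel_pair.nn_integral_snd[OF f2] by simp
  finally show "emeasure (distr lborel borel (\<lambda>(x, y). (x + a * y, y))) A = emeasure lborel A"
    by (simp add: lborel_prod)
qed simp

lemma swap_distr:
  "distr lborel borel (\<lambda>(x, y). (y, x)) = (lborel :: (real \<times> real) measure)"
proof -
  have "distr (lborel \<Otimes>\<^sub>M lborel) (lborel \<Otimes>\<^sub>M lborel) (\<lambda>(x, y). (y, x)) = lborel \<Otimes>\<^sub>M (lborel :: real measure)"
    using lborel_pair.distr_pair_swap[symmetric] by simp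
  then show ?thesis by (metis distr_cong lborel_prod sets_lborel)
qed

text \<open>Conjugating the first shear by the exchange of coordinates gives the shear along the
  other axis.\<close>

lemma shear_distr_snd:
  "distr lborel borel (\<lambda>(x, y). (x, y + b * x)) = (lborel :: (real \<times> real) measure)"
proof -
  have "distr lborel borel (\<lambda>(x, y). (x, y + b * x))
      = distr (distr (distr lborel borel (\<lambda>(x, y). (y, x))) borel (\<lambda>(x, y). (x + b * y, y))) borel (\<lambda>(x, y). (y, x :: real))"
    by (simp add: distr_distr o_def case_prod_unfold split_beta)
  then show ?thesis by (simp add: shear_distr swap_distr)
qed

lemma measurable_rot [measurable]: "rot \<theta> \<in> borel \<rightarrow>\<^sub>M borel"
  unfolding rot_def case_prod_unfold by measurable

lemma rot_add: "rot \<alpha> (rot \<beta> z) = rot (\<alpha> + \<beta>) z"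
  by (auto simp: rot_def cos_add sin_add algebra_simps split: prod.split)

text \<open>A rotation by an angle that is not a multiple of \<open>\<pi>\<close> is a product of three shears.\<close>

lemma rot_distr_sin:
  assumes "sin \<theta> \<noteq> 0"
  shows "distr lborel borel (rot \<theta>) = lborel"
proof -
  \<comment> \<open>This is \<open>- tan (\<theta> / 2)\<close>, forced by the requirement
    \<open>1 + a * sin \<theta> = cos \<theta>\<close> on the diagonal of the product.\<close>
  define a where "a = (cos \<theta> - 1) / sin \<theta>"
  have e1: "1 + a * sin \<theta> = cos \<theta>" using assms by (simp add: a_def)
  have e2: "a + cos \<theta> * a = - sin \<theta>"
  proof -
    have "(cos \<theta> - 1) * (1 + cos \<theta>) = - (sin \<theta>)\<^sup>2"
      using sin_cos_squared_add[of \<theta>] by (simp add: algebra_simps power2_eq_square)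
    then show ?thesis using assms by (simp add: a_def divide_simps) (simp add: algebra_simps power2_eq_square)
  qed
  have e: "rot \<theta> = (\<lambda>(x, y). (x + a * y, y)) \<circ> (\<lambda>(x, y). (x, y + sin \<theta> * x)) \<circ> (\<lambda>(x, y). (x + a * y, y))"
  proof
    fix z :: "real \<times> real"
    obtain x y where z: "z = (x, y)" by (cases z)
    have "x + a * y + a * (y + sin \<theta> * (x + a * y)) = x * (1 + a * sin \<theta>) + y * (a + (1 + a * sin \<theta>) * a)"
      by (simp add: algebra_simps)
    also have "\<dots> = x * cos \<theta> - y * sin \<theta>" using e2 by (simp add: e1)
    finally have 1: "x + a * y + a * (y + sin \<theta> * (x + a * y)) = x * cos \<theta> - y * sin \<theta>" .
    have "y + sin \<theta> * (x + a * y) = x * sin \<theta> + y * (1 + a * sin \<theta>)" by (simp add: algebra_simps)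
    then have 2: "y + sin \<theta> * (x + a * y) = x * sin \<theta> + y * cos \<theta>" by (simp add: e1)
    show "rot \<theta> z = ((\<lambda>(x, y). (x + a * y, y)) \<circ> (\<lambda>(x, y). (x, y + sin \<theta> * x)) \<circ> (\<lambda>(x, y). (x + a * y, y))) z"
      using 1 2 by (simp add: z rot_def)
  qed
  have "distr lborel borel (rot \<theta>) =
    distr (distr (distr lborel borel (\<lambda>(x, y). (x + a * y, y))) borel (\<lambda>(x, y). (x, y + sin \<theta> * x))) borel (\<lambda>(x, y). (x + a * y, y))"
    unfolding e by (simp add: distr_distr o_def case_prod_unfold)
  then show ?thesis by (simp add: shear_distr shear_distr_snd)
qed

lemma rot_distr: "distr lborel borel (rot \<theta>) = lborel"
proof (cases "sin \<theta> = 0")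
  case False then show ?thesis by (rule rot_distr_sin)
next
  case True
  \<comment> \<open>Splitting off a quarter turn writes an exceptional angle as a sum of two angles
    with nonzero sine.\<close>
  have s: "sin (\<theta> - pi/2) \<noteq> 0" using True sin_cos_squared_add[of \<theta>] by (auto simp: sin_diff)
  have "rot \<theta> = rot (pi/2) \<circ> rot (\<theta> - pi/2)" by (auto simp: rot_add)
  then have "distr lborel borel (rot \<theta>) = distr (distr lborel borel (rot (\<theta> - pi/2))) borel (rot (pi/2))"
    by (simp add: distr_distr)
  then show ?thesis by (simp add: rot_distr_sin s)
qed

lemma norm_sq_rot: "(fst (rot \<theta> z))\<^sup>2 + (snd (rot \<theta> z))\<^sup>2 = (fst z)\<^sup>2 + (snd z)\<^sup>2"
proof -
  obtain x y where z: "z = (x, y)" by (cases z)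
  have "(x * cos \<theta> - y * sin \<theta>)\<^sup>2 + (x * sin \<theta> + y * cos \<theta>)\<^sup>2 = (x\<^sup>2 + y\<^sup>2) * ((sin \<theta>)\<^sup>2 + (cos \<theta>)\<^sup>2)"
    by (simp only: power2_eq_square) algebra
  then show ?thesis by (simp add: z rot_def)
qed

lemma B2_iff: "z \<in> B2 \<longleftrightarrow> (fst z)\<^sup>2 + (snd z)\<^sup>2 \<le> 1"
  by (cases z) (simp add: dist_Pair_Pair dist_real_def)

lemma rot_B2_iff: "rot \<theta> z \<in> B2 \<longleftrightarrow> z \<in> B2"
  by (simp only: B2_iff norm_sq_rot)

lemma W_rot: "W \<mu> (rot \<theta> z) = W \<mu> z"
  using norm_sq_rot[of \<theta> z] by (simp add: W_def case_prod_unfold diff_diff_eq)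

section \<open>Radial integrals over the disc\<close>

definition nsq :: "real \<times> real \<Rightarrow> real" where "nsq z = (fst z)\<^sup>2 + (snd z)\<^sup>2"

lemma measurable_nsq [measurable]: "nsq \<in> borel \<rightarrow>\<^sub>M borel"
  unfolding nsq_def[abs_def] by measurable

text \<open>A substitute for polar coordinates: the set where \<open>nsq\<close> is at most
  \<open>u\<close> is a disc of area \<open>pi * u\<close>, so the squared norm is uniformly
  distributed. Both measures are finite, hence determined by their values on upper rays.\<close>

lemma disc_nsq_distr:
  "distr (density lborel (indicator B2)) borel nsq = density lborel (\<lambda>u. ennreal pi * indicator {0..1} u)"
proof (rule measure_eqI_lessThan)
  have E: "emeasure lborel {z. nsq z \<le> u} = ennreal (pi * u)" if "u \<ge> 0" for u
  proof -
    have "{z. nsq z \<le> u} = cball (0, 0) (sqrt u)"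
      using that by (auto simp: nsq_def dist_Pair_Pair dist_real_def real_sqrt_le_iff)
    moreover have "unit_ball_vol 2 = pi"
      using unit_ball_vol_even[of 1] by (simp)
    ultimately show ?thesis using that
      by (simp add: emeasure_cball)
  qed
  fix x :: real
  have [measurable]: "B2 \<in> sets borel" by simp
  have "emeasure (distr (density lborel (indicator B2)) borel nsq) {x<..} 
     = emeasure (density lborel (indicator B2)) (nsq -` {x<..})"
    by (simp add: emeasure_distr)
  also have "\<dots> = emeasure lborel (B2 \<inter> nsq -` {x<..})"
  proof -
    have "nsq -` {x<..} \<in> sets borel"
      using measurable_sets_borel[OF measurable_nsq, of "{x<..}"] by simp
    then show ?thesis
      by (simp add: emeasure_density indicator_inter_arith[symmetric] sets.Int)
  qed
  also have "\<dots> = ennreal (if x < 0 then pi else if x \<le> 1 then pi * (1 - x) else 0)"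
  proof -
    have B: "B2 = {z. nsq z \<le> 1}" using B2_iff by (auto simp: nsq_def)
    consider "x < 0" | "0 \<le> x" "x \<le> 1" | "x > 1" by linarith
    then show ?thesis
    proof cases
      case 1
      then have "B2 \<inter> nsq -` {x<..} = {z. nsq z \<le> 1}"
        unfolding B by (auto simp: nsq_def intro: less_le_trans[OF _ sum_power2_ge_zero])
      then show ?thesis using E[of 1] 1 by simp
    next
      case 2
      have "B2 \<inter> nsq -` {x<..} = {z. nsq z \<le> 1} - {z. nsq z \<le> x}"
        unfolding B by auto
      moreover have "emeasure lborel ({z. nsq z \<le> 1} - {z. nsq z \<le> x}) = ennreal (pi * 1) - ennreal (pi * x)"
        using 2 by (subst emeasure_Diff) (auto simp: E)
      ultimately show ?thesis using 2 by (simp add: ennreal_minus algebra_simps)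
    next
      case 3
      then have "B2 \<inter> nsq -` {x<..} = {}" unfolding B by auto
      then show ?thesis using 3 by simp
    qed
  qed
  finally have L: "emeasure (distr (density lborel (indicator B2)) borel nsq) {x<..} 
    = ennreal (if x < 0 then pi else if x \<le> 1 then pi * (1 - x) else 0)" .
  then show "emeasure (distr (density lborel (indicator B2)) borel nsq) {x<..} < \<infinity>" by simp
  have "emeasure (density lborel (\<lambda>u. ennreal pi * indicator {0..1} u)) {x<..}
      = ennreal pi * emeasure lborel ({0..1} \<inter> {x<..})"
    by (subst emeasure_density, measurable)
       (simp add: mult.assoc nn_integral_cmult indicator_inter_arith[symmetric])
  also have "\<dots> = ennreal (if x < 0 then pi else if x \<le> 1 then pi * (1 - x) else 0)"
  proof -
    have "{0..1} \<inter> {x<..} = (if x < 0 then {0..1} else {x<..1})" by auto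
    then show ?thesis by (simp add: ennreal_mult[symmetric])
  qed
  finally show "emeasure (distr (density lborel (indicator B2)) borel nsq) {x<..} =
    emeasure (density lborel (\<lambda>u. ennreal pi * indicator {0..1} u)) {x<..}"
    using L by simp
qed simp_all

text \<open>All integrals of the statement are over the completed measure, whereas substitution and
  Fubini are applied to \<open>lborel\<close>; for Borel integrands the two may be
  exchanged.\<close>

lemma set_lebesgue_eq_lborel:
  fixes f :: "'a::euclidean_space \<Rightarrow> real"
  assumes "f \<in> borel_measurable borel" "A \<in> sets borel"
  shows "set_lebesgue_integral lebesgue A f = set_lebesgue_integral lborel A f"
    and "set_integrable lebesgue A f \<longleftrightarrow> set_integrable lborel A f"
  using assms unfolding set_lebesgue_integral_def set_integrable_def
  by (auto intro!: integral_completion integrable_completion)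

lemma disc_rot:
  fixes F :: "real \<times> real \<Rightarrow> real"
  assumes F: "F \<in> borel_measurable borel"
  shows "(LINT z:B2|lebesgue. F (rot \<theta> z)) = (LINT z:B2|lebesgue. F z)"
proof -
  have [measurable]: "B2 \<in> sets borel" by simp
  note F[measurable]
  have "(LINT z:B2|lebesgue. F z) = (LINT z:B2|distr lborel borel (rot \<theta>). F z)"
    by (simp add: set_lebesgue_eq_lborel rot_distr)
  also have "\<dots> = (LINT z:B2|lborel. F (rot \<theta> z))"
    unfolding set_lebesgue_integral_def
    by (subst integral_distr) (auto simp: rot_B2_iff indicator_def simp del: mem_cball intro!: Bochner_Integration.integral_cong)
  also have "\<dots> = (LINT z:B2|lebesgue. F (rot \<theta> z))"
    by (subst set_lebesgue_eq_lborel) auto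
  finally show ?thesis by simp
qed

lemma disc_radial:
  assumes g[measurable]: "g \<in> borel_measurable borel"
  shows "(LINT z:B2|lebesgue. g (nsq z)) = pi * (LINT u:{0..1}|lborel. g u)"
    and "set_integrable lebesgue B2 (\<lambda>z. g (nsq z)) \<longleftrightarrow> set_integrable lborel {0..1} g"
proof -
  have [measurable]: "B2 \<in> sets borel" by simp
  have "density lborel (indicator B2) = density lborel (\<lambda>x. ennreal (indicator B2 x :: real))"
    by (simp add: ennreal_indicator)
  then have 1: "(\<integral>z. g (nsq z) \<partial>density lborel (indicator B2)) = (LINT z:B2|lborel. g (nsq z))"
    "integrable (density lborel (indicator B2)) (\<lambda>z. g (nsq z)) \<longleftrightarrow> set_integrable lborel B2 (\<lambda>z. g (nsq z))"
    unfolding set_lebesgue_integral_def set_integrable_def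
    by (simp_all add: integral_density integrable_density)
  have "density lborel (\<lambda>u. ennreal pi * indicator {0..1} u) = density lborel (\<lambda>u. ennreal (pi * indicator {0..1} (u::real)))"
    by (simp add: ennreal_indicator ennreal_mult)
  then have 2: "(\<integral>u. g u \<partial>density lborel (\<lambda>u. ennreal pi * indicator {0..1} u)) = pi * (LINT u:{0..1}|lborel. g u)"
    "integrable (density lborel (\<lambda>u. ennreal pi * indicator {0..1} u)) g \<longleftrightarrow> set_integrable lborel {0..1} g"
    unfolding set_lebesgue_integral_def set_integrable_def
    by (simp_all add: integral_density integrable_density mult.assoc)
  have 3: "(\<integral>u. g u \<partial>distr (density lborel (indicator B2)) borel nsq) = (\<integral>z. g (nsq z) \<partial>density lborel (indicator B2))"
    "integrable (distr (density lborel (indicator B2)) borel nsq) g \<longleftrightarrow> integrable (density lborel (indicator B2)) (\<lambda>z. g (nsq z))"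
    by (simp_all add: integral_distr integrable_distr_eq)
  show "(LINT z:B2|lebesgue. g (nsq z)) = pi * (LINT u:{0..1}|lborel. g u)"
    using 1 2 3 by (simp add: set_lebesgue_eq_lborel disc_nsq_distr)
  show "set_integrable lebesgue B2 (\<lambda>z. g (nsq z)) \<longleftrightarrow> set_integrable lborel {0..1} g"
    using 1 2 3 by (simp add: set_lebesgue_eq_lborel disc_nsq_distr)
qed


text \<open>Completeness of Lebesgue measure: preimages under \<open>f\<close> and \<open>g\<close>
  differ by a subset of a null set. This supplies measurability for integrands known only almost
  everywhere, such as the Radon projection as a function of \<open>t\<close>.\<close>

lemma borel_measurable_lebesgue_AE:
  fixes f g :: "'a::euclidean_space \<Rightarrow> real"
  assumes g: "g \<in> borel_measurable borel" and ae: "AE x in lborel. f x = g x"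
  shows "f \<in> borel_measurable lebesgue"
proof (rule measurableI)
  fix A :: "real set" assume A: "A \<in> sets borel"
  have "g -` A \<in> sets lebesgue"
    using measurable_sets_borel[OF g A] by (simp add: sets_completionI_sets)
  moreover have "AE x in lebesgue. x \<in> g -` A \<longleftrightarrow> x \<in> f -` A"
    using AE_completion[OF ae] by eventually_elim auto
  ultimately show "f -` A \<inter> space lebesgue \<in> sets lebesgue"
    by (simp add: completion.in_sets_AE[of "g -` A" "f -` A"])
qed simp

text \<open>Since \<open>f\<close> is only Lebesgue measurable, its restriction to a line need not be measurable; this
  happens for a null set of lines only.\<close>

lemma radon_integral:
  fixes f :: "real \<times> real \<Rightarrow> real" and g :: "real \<Rightarrow> real"
  assumes int: "set_integrable lebesgue B2 (\<lambda>z. f z * g (fst z * cos \<theta> + snd z * sin \<theta>) * W \<mu> z)"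
  shows "(LINT t:{-1..1}|lebesgue. radon \<mu> \<theta> f t * g t)
       = (LINT z:B2|lebesgue. f z * g (fst z * cos \<theta> + snd z * sin \<theta>) * W \<mu> z)"
proof -
  define F where "F z = indicator B2 z * (f z * g (fst z * cos \<theta> + snd z * sin \<theta>) * W \<mu> z)" for z
  have F: "integrable lebesgue F" using int by (simp add: set_integrable_def F_def[abs_def])
  \<comment> \<open>Rotation and Fubini are carried out for a Borel representative; \<open>F\<close>
    itself is put back afterwards, line by line.\<close>
  obtain F' where F'[measurable]: "F' \<in> borel_measurable lborel" and ae: "AE z in lborel. F z = F' z"
    using completion_ex_borel_measurable_real[of F lborel] F by auto
  have F'b[measurable]: "F' \<in> borel_measurable borel" using F' by simp
  have F'l: "F' \<in> borel_measurable lebesgue" using F' by (rule measurable_completion)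
  have "integrable lebesgue F'"
    using F integrable_cong_AE[of F lebesgue F'] F'l AE_completion[OF ae] by auto
  then have iF': "integrable lborel F'" using integrable_completion[OF F'] by simp
  have 1: "(\<integral>z. F z \<partial>lebesgue) = (\<integral>z. F' z \<partial>lborel)"
    using integral_cong_AE[of F lebesgue F'] F F'l AE_completion[OF ae] integral_completion[OF F'] by auto
  have rm: "rot \<theta> \<in> lborel \<rightarrow>\<^sub>M borel" by simp
  have 2: "(\<integral>z. F' z \<partial>lborel) = (\<integral>p. F' (rot \<theta> p) \<partial>lborel)"
    using integral_distr[OF rm F'b] by (simp add: rot_distr)
  have i2: "integrable lborel (\<lambda>p. F' (rot \<theta> p))"
    using integrable_distr_eq[OF rm F'b] iF' by (simp add: rot_distr)
  have aer: "AE p in lborel. F (rot \<theta> p) = F' (rot \<theta> p)"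
    by (rule AE_distrD[OF rm, unfolded rot_distr, OF ae])
  have ae2: "AE t in lborel. AE s in lborel. F (rot \<theta> (t, s)) = F' (rot \<theta> (t, s))"
    by (rule lborel_pair.AE_pair) (use aer in \<open>simp only: lborel_prod\<close>)
  have 3: "(\<integral>p. F' (rot \<theta> p) \<partial>lborel) = (\<integral>t. (\<integral>s. F' (rot \<theta> (t, s)) \<partial>lborel) \<partial>lborel)"
    using lborel_pair.integral_fst'[of "\<lambda>p. F' (rot \<theta> p)"] i2 by (simp add: lborel_prod)
  \<comment> \<open>This holds for every \<open>t\<close>: after the rotation the indicator of the
    disc factors into that of the range of \<open>t\<close> and that of the chord, while the
    argument of \<open>g\<close> becomes \<open>t\<close>.\<close>
  have ptw: "(\<integral>s. F (rot \<theta> (t, s)) \<partial>lebesgue) = indicator {-1..1} t * (radon \<mu> \<theta> f t * g t)" for t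
  proof -
    have "F (rot \<theta> (t, s)) = indicator {-1..1} t * ((indicator {- sqrt (1 - t\<^sup>2)..sqrt (1 - t\<^sup>2)} s *
        (f (t * cos \<theta> - s * sin \<theta>, t * sin \<theta> + s * cos \<theta>) *
        (1 - s\<^sup>2 - t\<^sup>2) powr (\<mu> - 1/2))) * g t)" for s
    proof -
      have "(t * cos \<theta> - s * sin \<theta>) * cos \<theta> + (t * sin \<theta> + s * cos \<theta>) * sin \<theta> = t * ((sin \<theta>)\<^sup>2 + (cos \<theta>)\<^sup>2)"
        by (simp only: power2_eq_square) algebra
      then have e: "(t * cos \<theta> - s * sin \<theta>) * cos \<theta> + (t * sin \<theta> + s * cos \<theta>) * sin \<theta> = t" by simp
      have b: "rot \<theta> (t, s) \<in> B2 \<longleftrightarrow> t \<in> {-1..1} \<and> s \<in> {- sqrt (1 - t\<^sup>2)..sqrt (1 - t\<^sup>2)}"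
      proof -
        have "t\<^sup>2 + s\<^sup>2 \<le> 1 \<longleftrightarrow> t\<^sup>2 \<le> 1 \<and> s\<^sup>2 \<le> 1 - t\<^sup>2"
          using zero_le_power2[of s] by linarith
        also have "t\<^sup>2 \<le> 1 \<longleftrightarrow> t \<in> {-1..1}"
          using abs_square_le_1[of t] by (auto simp: abs_le_iff)
        also have "t \<in> {-1..1} \<and> s\<^sup>2 \<le> 1 - t\<^sup>2 \<longleftrightarrow> t \<in> {-1..1} \<and> \<bar>s\<bar> \<le> sqrt (1 - t\<^sup>2)"
          using real_sqrt_le_iff[of "s\<^sup>2" "1 - t\<^sup>2"] by simp
        also have "\<bar>s\<bar> \<le> sqrt (1 - t\<^sup>2) \<longleftrightarrow> s \<in> {- sqrt (1 - t\<^sup>2)..sqrt (1 - t\<^sup>2)}"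
          by auto
        finally show ?thesis by (simp only: rot_B2_iff) (simp only: B2_iff fst_conv snd_conv)
      qed
      have "W \<mu> (rot \<theta> (t, s)) = (1 - s\<^sup>2 - t\<^sup>2) powr (\<mu> - 1/2)"
        by (simp only: W_rot) (simp add: W_def algebra_simps)
      with e b show ?thesis
        by (simp add: F_def indicator_def rot_def del: mem_cball)
    qed
    then show ?thesis
      by (simp add: radon_def set_lebesgue_integral_def)
  qed
  have inner: "AE t in lborel. indicator {-1..1} t * (radon \<mu> \<theta> f t * g t) = (\<integral>s. F' (rot \<theta> (t, s)) \<partial>lborel)"
    using ae2
  proof eventually_elim
    case (elim t)
    have m: "(\<lambda>s. F' (rot \<theta> (t, s))) \<in> borel_measurable borel" by measurable
    have "(\<integral>s. F (rot \<theta> (t, s)) \<partial>lebesgue) = (\<integral>s. F' (rot \<theta> (t, s)) \<partial>lebesgue)"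
      using elim m by (intro integral_cong_AE borel_measurable_lebesgue_AE[OF m elim] AE_completion) 
        (auto intro: measurable_completion)
    also have "\<dots> = (\<integral>s. F' (rot \<theta> (t, s)) \<partial>lborel)"
      using m by (intro integral_completion) simp
    finally show ?case by (simp add: ptw)
  qed
  have om: "(\<lambda>t. \<integral>s. F' (rot \<theta> (t, s)) \<partial>lborel) \<in> borel_measurable borel"
    by measurable
  have "(LINT t:{-1..1}|lebesgue. radon \<mu> \<theta> f t * g t) = (\<integral>t. (\<integral>s. F' (rot \<theta> (t, s)) \<partial>lborel) \<partial>lebesgue)"
    unfolding set_lebesgue_integral_def using inner om
    by (intro integral_cong_AE borel_measurable_lebesgue_AE[OF om] AE_completion) 
       (auto intro: measurable_completion)
  also have "\<dots> = (\<integral>t. (\<integral>s. F' (rot \<theta> (t, s)) \<partial>lborel) \<partial>lborel)"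
    using om by (intro integral_completion) simp
  finally show ?thesis
    using 1 2 3 by (simp add: set_lebesgue_integral_def F_def[abs_def])
qed

section \<open>Polynomials in two variables\<close>

lemma poly2_le_zero: "(\<lambda>_. 0) \<in> poly2_le n"
  unfolding poly2_le_def by (auto intro!: exI[of _ "\<lambda>_ _. 0"])

lemma poly2_le_add: "f \<in> poly2_le n \<Longrightarrow> g \<in> poly2_le n \<Longrightarrow> (\<lambda>z. f z + g z) \<in> poly2_le n"
proof -
  assume "f \<in> poly2_le n" "g \<in> poly2_le n"
  then obtain c d where "\<forall>x y. f (x, y) = (\<Sum>i\<le>n. \<Sum>j\<le>n - i. c i j * x ^ i * y ^ j)"
    "\<forall>x y. g (x, y) = (\<Sum>i\<le>n. \<Sum>j\<le>n - i. d i j * x ^ i * y ^ j)"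
    unfolding poly2_le_def by auto
  then show ?thesis
    unfolding poly2_le_def
    by (auto intro!: exI[of _ "\<lambda>i j. c i j + d i j"] simp: sum.distrib algebra_simps)
qed

lemma poly2_le_scale: "f \<in> poly2_le n \<Longrightarrow> (\<lambda>z. a * f z) \<in> poly2_le n"
proof -
  assume "f \<in> poly2_le n"
  then obtain c where "\<forall>x y. f (x, y) = (\<Sum>i\<le>n. \<Sum>j\<le>n - i. c i j * x ^ i * y ^ j)"
    unfolding poly2_le_def by auto
  then show ?thesis
    unfolding poly2_le_def
    by (auto intro!: exI[of _ "\<lambda>i j. a * c i j"] simp: sum_distrib_left algebra_simps)
qed

lemma poly2_le_monom:
  assumes "i + j \<le> n"
  shows "(\<lambda>z. fst z ^ i * snd z ^ j) \<in> poly2_le n"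
proof -
  have "(\<Sum>a\<le>n. \<Sum>b\<le>n - a. (if a = i \<and> b = j then 1 else 0) * x ^ a * y ^ b) = x ^ i * y ^ j" for x y :: real
  proof -
    have "(\<Sum>a\<le>n. \<Sum>b\<le>n - a. (if a = i \<and> b = j then 1 else 0) * x ^ a * y ^ b) =
      (\<Sum>a\<le>n. \<Sum>b\<le>n - a. if b = j then if a = i then x ^ i * y ^ j else 0 else 0)"
      by (intro sum.cong refl) auto
    also have "\<dots> = (\<Sum>a\<le>n. if a = i then x ^ i * y ^ j else 0)"
      using assms by (intro sum.cong refl) (auto simp: sum.delta)
    also have "\<dots> = x ^ i * y ^ j" using assms by (simp add: sum.delta)
    finally show ?thesis .
  qed
  then show ?thesis
    unfolding poly2_le_def by (auto intro!: exI[of _ "\<lambda>a b. if a = i \<and> b = j then 1 else 0"])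
qed

lemma closed_sum:
  assumes "P (\<lambda>_. 0)" "\<And>f g. P f \<Longrightarrow> P g \<Longrightarrow> P (\<lambda>z. f z + g z)"
    and "finite A" "\<And>i. i \<in> A \<Longrightarrow> P (h i)"
  shows "P (\<lambda>z. \<Sum>i\<in>A. h i z :: real)"
  using assms(3,4) by (induction A rule: finite_induct) (auto simp: assms(1,2))

lemma poly2_le_sum:
  "finite A \<Longrightarrow> (\<And>i. i \<in> A \<Longrightarrow> h i \<in> poly2_le n) \<Longrightarrow> (\<lambda>z. \<Sum>i\<in>A. h i z) \<in> poly2_le n"
  by (rule closed_sum[where P = "\<lambda>f. f \<in> poly2_le n"]) (auto intro: poly2_le_zero poly2_le_add)

text \<open>The monomials span, so a property closed under linear combinations has to be checked on
  monomials only; this avoids coefficient arrays in what follows.\<close>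

lemma poly2_le_induct [consumes 1, case_names zero add scale monom]:
  assumes Q: "Q \<in> poly2_le n"
    and zero: "P (\<lambda>_. 0)" and add: "\<And>f g. P f \<Longrightarrow> P g \<Longrightarrow> P (\<lambda>z. f z + g z)"
    and scale: "\<And>a f. P f \<Longrightarrow> P (\<lambda>z. a * f z)"
    and monom: "\<And>i j. i + j \<le> n \<Longrightarrow> P (\<lambda>z. fst z ^ i * snd z ^ j)"
  shows "P Q"
proof -
  obtain c where "\<forall>x y. Q (x, y) = (\<Sum>i\<le>n. \<Sum>j\<le>n - i. c i j * x ^ i * y ^ j)"
    using Q unfolding poly2_le_def by auto
  then have Q_eq: "Q = (\<lambda>z. \<Sum>i\<le>n. \<Sum>j\<le>n - i. c i j * (fst z ^ i * snd z ^ j))"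
    by (auto simp: mult.assoc)
  show ?thesis
    unfolding Q_eq by (intro closed_sum[of P, OF zero add] scale monom) auto
qed

lemma poly2_le_mono:
  assumes "n \<le> m" shows "poly2_le n \<subseteq> poly2_le m"
proof
  fix Q assume "Q \<in> poly2_le n"
  then show "Q \<in> poly2_le m"
    using assms by (induction rule: poly2_le_induct) (auto intro: poly2_le_zero poly2_le_add poly2_le_scale poly2_le_monom)
qed

lemma poly2_le_mult:
  assumes f: "f \<in> poly2_le n" and g: "g \<in> poly2_le m"
  shows "(\<lambda>z. f z * g z) \<in> poly2_le (n + m)"
  using f
proof (induction rule: poly2_le_induct)
  case (monom i j)
  show ?case using g
  proof (induction rule: poly2_le_induct)
    case (monom i' j')
    have "(\<lambda>z. fst z ^ (i + i') * snd z ^ (j + j') :: real) \<in> poly2_le (n + m)"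
      using monom \<open>i + j \<le> n\<close> by (intro poly2_le_monom) auto
    then show ?case by (simp add: power_add mult_ac)
  next
    case (add f g)
    from poly2_le_add[OF this] show ?case by (simp add: distrib_left)
  next
    case (scale a f)
    from poly2_le_scale[OF this, of a] show ?case by (simp add: mult.left_commute)
  qed (simp add: poly2_le_zero)
next
  case (add f g)
  from poly2_le_add[OF this] show ?case by (simp add: distrib_right)
next
  case (scale a f)
  from poly2_le_scale[OF this, of a] show ?case by (simp add: mult.assoc)
qed (simp add: poly2_le_zero)

lemma poly2_le_const: "(\<lambda>_. a) \<in> poly2_le n"
  using poly2_le_scale[OF poly2_le_monom[of 0 0 n], of a] by simp

lemma poly2_le_power:
  assumes "f \<in> poly2_le n" shows "(\<lambda>z. f z ^ i) \<in> poly2_le (i * n)"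
proof (induction i)
  case (Suc i) then show ?case using poly2_le_mult[OF assms Suc] by simp
qed (simp add: poly2_le_const)

lemma poly2_le_poly:
  assumes f: "f \<in> poly2_le n" and d: "degree p * n \<le> m"
  shows "(\<lambda>z. poly p (f z)) \<in> poly2_le m"
  unfolding poly_altdef
proof (intro poly2_le_sum poly2_le_scale)
  fix i assume "i \<in> {..degree p}"
  then have "i * n \<le> m" using d by (meson atMost_iff le_trans mult_le_mono1)
  then show "(\<lambda>z. f z ^ i) \<in> poly2_le m"
    using poly2_le_power[OF f, of i] poly2_le_mono by blast
qed simp

lemma poly2_le_linear: "(\<lambda>z. a * fst z + b * snd z) \<in> poly2_le 1"
  using poly2_le_add[OF poly2_le_scale[OF poly2_le_monom[of 1 0 1], of a] poly2_le_scale[OF poly2_le_monom[of 0 1 1], of b]]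
  by simp

lemma poly2_le_rot:
  assumes "Q \<in> poly2_le n" shows "(\<lambda>z. Q (rot \<theta> z)) \<in> poly2_le n"
  using assms
proof (induction rule: poly2_le_induct)
  case (monom i j)
  have 1: "(\<lambda>z. fst (rot \<theta> z)) \<in> poly2_le 1" "(\<lambda>z. snd (rot \<theta> z)) \<in> poly2_le 1"
    using poly2_le_linear[of "cos \<theta>" "- sin \<theta>"] poly2_le_linear[of "sin \<theta>" "cos \<theta>"]
    by (simp_all add: rot_def case_prod_unfold mult.commute)
  have "(\<lambda>z. fst (rot \<theta> z) ^ i * snd (rot \<theta> z) ^ j) \<in> poly2_le (i * 1 + j * 1)"
    by (intro poly2_le_mult poly2_le_power 1)
  then show ?case using monom poly2_le_mono[of "i * 1 + j * 1" n] by auto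
qed (auto intro: poly2_le_zero poly2_le_add poly2_le_scale)

lemma poly2_le_continuous: "Q \<in> poly2_le n \<Longrightarrow> continuous_on UNIV Q"
  by (induction rule: poly2_le_induct) (auto intro!: continuous_intros)

lemma poly2_le_nsq: "nsq \<in> poly2_le 2"
  using poly2_le_add[OF poly2_le_monom[of 2 0 2] poly2_le_monom[of 0 2 2]]
  by (simp add: nsq_def[abs_def])

text \<open>The solid harmonics \<open>r ^ j * cos (j * \<phi>)\<close> and
  \<open>r ^ j * sin (j * \<phi>)\<close>, written as real and imaginary parts of a complex power so
  that they are polynomials without reference to an angle.\<close>

definition harm :: "nat \<Rightarrow> nat \<Rightarrow> real \<times> real \<Rightarrow> real" where
  "harm j \<epsilon> z = (if \<epsilon> = 0 then Re (Complex (fst z) (snd z) ^ j) else Im (Complex (fst z) (snd z) ^ j))"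

lemma poly2_le_harm: "harm j \<epsilon> \<in> poly2_le j"
proof -
  have "(\<lambda>z. Re (Complex (fst z) (snd z) ^ j)) \<in> poly2_le j \<and> (\<lambda>z. Im (Complex (fst z) (snd z) ^ j)) \<in> poly2_le j"
  proof (induction j)
    case (Suc j)
    then have R: "(\<lambda>z. Re (Complex (fst z) (snd z) ^ j)) \<in> poly2_le j" and I: "(\<lambda>z. Im (Complex (fst z) (snd z) ^ j)) \<in> poly2_le j" by auto
    have x: "fst \<in> poly2_le 1" and y: "snd \<in> poly2_le 1"
      using poly2_le_monom[of 1 0 1] poly2_le_monom[of 0 1 1] by (simp_all)
    show ?case
      using poly2_le_add[OF poly2_le_mult[OF x R] poly2_le_scale[OF poly2_le_mult[OF y I], of "-1"]]
        poly2_le_add[OF poly2_le_mult[OF x I] poly2_le_mult[OF y R]]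
      by simp
  qed (simp add: poly2_le_const poly2_le_zero)
  then show ?thesis by (cases "\<epsilon> = 0") (auto simp: harm_def[abs_def])
qed

text \<open>A second spanning system for the polynomials of degree at most \<open>n\<close>, adapted
  to rotations. The pair \<epsilon> = 1, \<open>j = 0\<close> is left out, as in
  \<open>basis_index\<close>, because that harmonic is zero.\<close>

inductive harm_span :: "nat \<Rightarrow> (real \<times> real \<Rightarrow> real) \<Rightarrow> bool" for n where
  zero: "harm_span n (\<lambda>_. 0)"
| add: "harm_span n f \<Longrightarrow> harm_span n g \<Longrightarrow> harm_span n (\<lambda>z. f z + g z)"
| scale: "harm_span n f \<Longrightarrow> harm_span n (\<lambda>z. a * f z)"
| gen: "\<epsilon> = 0 \<or> \<epsilon> = 1 \<and> 0 < j \<Longrightarrow> 2 * i + j \<le> n \<Longrightarrow> harm_span n (\<lambda>z. nsq z ^ i * harm j \<epsilon> z)"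

lemma harm_span_mono: "harm_span n f \<Longrightarrow> n \<le> m \<Longrightarrow> harm_span m f"
  by (induction rule: harm_span.induct) (auto intro: harm_span.intros)

lemma harm_span_gen:
  assumes "2 * i + j \<le> n"
  shows "harm_span n (\<lambda>z. nsq z ^ i * harm j \<epsilon> z)"
proof -
  consider "\<epsilon> = 0" | "\<epsilon> > 0" "j > 0" | "\<epsilon> > 0" "j = 0" by linarith
  then show ?thesis
  proof cases
    case 2
    then have "harm j \<epsilon> = harm j 1" by (auto simp: harm_def)
    then show ?thesis using 2 assms harm_span.gen[of 1 j i n] by simp
  next
    case 3
    then show ?thesis by (simp add: harm_def harm_span.zero)
  qed (use assms harm_span.gen[of \<epsilon> j i n] in auto)
qed

text \<open>With \<open>w = x + i y\<close>, one has \<open>x = (w + conj w) / 2\<close>,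
  \<open>y = (w - conj w) / (2 i)\<close> and \<open>w * conj w = nsq\<close>: multiplying by a
  coordinate moves the frequency up by one and down by one, and the downward move costs a factor
  \<open>nsq\<close>.\<close>

lemma harm_mult_coord:
  "fst z * harm (Suc j) 0 z = 1/2 * harm (Suc (Suc j)) 0 z + 1/2 * (nsq z * harm j 0 z)"
  "fst z * harm (Suc j) 1 z = 1/2 * harm (Suc (Suc j)) 1 z + 1/2 * (nsq z * harm j 1 z)"
  "snd z * harm (Suc j) 0 z = 1/2 * harm (Suc (Suc j)) 1 z + (-1/2) * (nsq z * harm j 1 z)"
  "snd z * harm (Suc j) 1 z = (-1/2) * harm (Suc (Suc j)) 0 z + 1/2 * (nsq z * harm j 0 z)"
  by (simp_all add: harm_def nsq_def field_simps power2_eq_square)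

lemma harm_span_coord:
  assumes "harm_span n f"
  shows "harm_span (Suc n) (\<lambda>z. fst z * f z) \<and> harm_span (Suc n) (\<lambda>z. snd z * f z)"
  using assms
proof (induction rule: harm_span.induct)
  case zero then show ?case by (simp add: harm_span.zero)
next
  case (add f g) then show ?case using harm_span.add by (fastforce simp: distrib_left)
next
  case (scale f a) 
  then have "harm_span (Suc n) (\<lambda>z. a * (fst z * f z))" "harm_span (Suc n) (\<lambda>z. a * (snd z * f z))"
    using harm_span.scale by blast+
  then show ?case by (simp add: mult.left_commute)
next
  case (gen \<epsilon> j i)
  show ?case
  proof (cases j)
    \<comment> \<open>Frequency 0 cannot be lowered; here the coordinates themselves are the two
      harmonics of frequency 1.\<close>
    case 0
    then have "\<epsilon> = 0" using gen by simp
    then have "harm_span (Suc n) (\<lambda>z. nsq z ^ i * harm 1 0 z)" "harm_span (Suc n) (\<lambda>z. nsq z ^ i * harm 1 1 z)"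
      using gen 0 by (auto intro!: harm_span_gen)
    then show ?thesis using 0 \<open>\<epsilon> = 0\<close> by (simp add: harm_def mult.commute)
  next
    case (Suc j')
    have a: "harm_span (Suc n) (\<lambda>z. nsq z ^ i * harm (Suc (Suc j')) \<epsilon> z)" 
      "harm_span (Suc n) (\<lambda>z. nsq z ^ Suc i * harm j' \<epsilon> z)" for \<epsilon>
      by (rule harm_span_gen; use gen Suc in simp)+
    have b: "harm_span (Suc n) (\<lambda>z. c * (nsq z ^ i * harm (Suc (Suc j')) \<epsilon> z) + d * (nsq z ^ Suc i * harm j' \<epsilon> z))" for c d \<epsilon>
      by (intro harm_span.add harm_span.scale a)
    have e: "fst z * (nsq z ^ i * harm (Suc j') 0 z) = 1/2 * (nsq z ^ i * harm (Suc (Suc j')) 0 z) + 1/2 * (nsq z ^ Suc i * harm j' 0 z)"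
      "fst z * (nsq z ^ i * harm (Suc j') 1 z) = 1/2 * (nsq z ^ i * harm (Suc (Suc j')) 1 z) + 1/2 * (nsq z ^ Suc i * harm j' 1 z)"
      "snd z * (nsq z ^ i * harm (Suc j') 0 z) = 1/2 * (nsq z ^ i * harm (Suc (Suc j')) 1 z) + (-1/2) * (nsq z ^ Suc i * harm j' 1 z)"
      "snd z * (nsq z ^ i * harm (Suc j') 1 z) = (-1/2) * (nsq z ^ i * harm (Suc (Suc j')) 0 z) + 1/2 * (nsq z ^ Suc i * harm j' 0 z)"
      for z
    proof -
      have c: "a * (nsq z ^ i * h) = nsq z ^ i * (a * h)" for a h by (rule mult.left_commute)
      show "fst z * (nsq z ^ i * harm (Suc j') 0 z) = 1/2 * (nsq z ^ i * harm (Suc (Suc j')) 0 z) + 1/2 * (nsq z ^ Suc i * harm j' 0 z)"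
        "fst z * (nsq z ^ i * harm (Suc j') 1 z) = 1/2 * (nsq z ^ i * harm (Suc (Suc j')) 1 z) + 1/2 * (nsq z ^ Suc i * harm j' 1 z)"
        "snd z * (nsq z ^ i * harm (Suc j') 0 z) = 1/2 * (nsq z ^ i * harm (Suc (Suc j')) 1 z) + (-1/2) * (nsq z ^ Suc i * harm j' 1 z)"
        "snd z * (nsq z ^ i * harm (Suc j') 1 z) = (-1/2) * (nsq z ^ i * harm (Suc (Suc j')) 0 z) + 1/2 * (nsq z ^ Suc i * harm j' 0 z)"
        unfolding c harm_mult_coord power_Suc2 by (simp_all only: distrib_left mult.assoc mult.left_commute[of "nsq z ^ i"])
    qed
    from gen(1) show ?thesis
      by (elim disjE conjE; simp only: Suc e; intro conjI b)
  qed
qed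

lemma harm_span_monom: "harm_span (i + j) (\<lambda>z. fst z ^ i * snd z ^ j)"
proof (induction i)
  case 0
  show ?case
  proof (induction j)
    case 0 show ?case using harm_span.gen[of 0 0 0 0] by (simp add: harm_def)
  next
    case (Suc j) then show ?case using harm_span_coord[of j "\<lambda>z. snd z ^ j"] by simp
  qed
next
  case (Suc i) then show ?case using harm_span_coord by (fastforce simp: mult.assoc)
qed

lemma poly2_le_harm_span: "Q \<in> poly2_le n \<Longrightarrow> harm_span n Q"
  by (induction rule: poly2_le_induct)
    (auto intro: harm_span.zero harm_span.add harm_span.scale harm_span_mono[OF harm_span_monom])

section \<open>Jacobi and Gegenbauer polynomials\<close>

lemma Beta_add_nat:
  fixes x y :: real
  assumes "x > 0" "y > 0"
  shows "Beta x (y + real i) = Beta x y * pochhammer y i / pochhammer (x + y) i"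
proof -
  have "Gamma x \<noteq> 0" "Gamma y \<noteq> 0" "Gamma (x + y) \<noteq> 0"
    "Gamma (x + (y + real i)) \<noteq> 0"
    using assms by (auto intro!: less_imp_neq[THEN not_sym] Gamma_real_pos)
  moreover have "pochhammer y i = Gamma (y + real i) / Gamma y"
    "pochhammer (x + y) i = Gamma (x + y + real i) / Gamma (x + y)"
    using assms by (auto intro!: pochhammer_Gamma simp: nonpos_Ints_def)
  ultimately show ?thesis by (simp add: Beta_def field_simps)
qed

lemma borel_measurable_poly [measurable]: "poly (p :: real poly) \<in> borel_measurable borel"
  by (intro borel_measurable_continuous_onI continuous_intros)

text \<open>On [0, 1] the moments are Beta values, so the Jacobi theory is developed there and moved
  to [-1, 1] afterwards. The inner product of \<open>p\<close> and \<open>q\<close> is the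
  functional at \<open>p * q\<close>.\<close>

definition beta_functional :: "real \<Rightarrow> real \<Rightarrow> real poly \<Rightarrow> real" where
  "beta_functional a b p = (LINT u:{0..1}|lborel. poly p u * (u powr a * (1 - u) powr b))"

lemma set_integrable_beta:
  assumes "a > -1" "b > -1"
  shows "set_integrable lborel {0..1} (\<lambda>u::real. poly p u * (u powr a * (1 - u) powr b))"
proof -
  have i: "set_integrable lborel {0..1} (\<lambda>u. u powr a * (1 - u) powr b)"
    using integrable_Beta[of "a + 1" "b + 1"] assms by simp
  have "compact (poly p ` {0..1})"
    by (intro compact_continuous_image continuous_intros) auto
  then have "bounded (poly p ` {0..1})" by (rule compact_imp_bounded)
  then obtain B where B: "\<And>u. u \<in> {0..1} \<Longrightarrow> \<bar>poly p u\<bar> \<le> B"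
    unfolding bounded_iff by (metis imageI real_norm_def)
  have "set_integrable lborel {0..1} (\<lambda>u. B * (u powr a * (1 - u) powr b))"
    using i by simp
  then show ?thesis
  proof (rule set_integrable_bound)
    show "set_borel_measurable lborel {0..1} (\<lambda>u. poly p u * (u powr a * (1 - u) powr b))"
      unfolding set_borel_measurable_def by measurable
    show "AE u in lborel. u \<in> {0..1} \<longrightarrow> norm (poly p u * (u powr a * (1 - u) powr b)) \<le> norm (B * (u powr a * (1 - u) powr b))"
    proof (intro AE_I2 impI)
      fix u :: real assume "u \<in> {0..1}"
      from B[OF this] show "norm (poly p u * (u powr a * (1 - u) powr b)) \<le> norm (B * (u powr a * (1 - u) powr b))"
        by (auto simp: abs_mult intro!: mult_right_mono)
    qed
  qed
qed

text \<open>The Jacobi polynomial, transported to \<open>[0, 1]\<close> and normalized to be \<open>1\<close> at \<open>1\<close>, as the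
  hypergeometric sum \<open>F(-l, l + a + b + 1; b + 1; 1 - u)\<close>. Testing it against \<open>u ^ n\<close> rather than
  \<open>(1 - u) ^ n\<close> leads to a sum of Chu-Vandermonde type.\<close>

definition beta_orth :: "real \<Rightarrow> real \<Rightarrow> nat \<Rightarrow> real poly" where
  "beta_orth a b l = (\<Sum>i\<in>{0..l}. smult (pochhammer (- real l) i * pochhammer (real l + a + b + 1) i /
     (pochhammer (b + 1) i * fact i)) ([:1, -1:] ^ i))"

text \<open>The squared norm of \<open>beta_orth a b l\<close> divided by the total mass of the
  weight. The division removes the Beta factor, leaving rising factorials, and agrees with the
  normalization in \<open>jacobi_inner\<close>.\<close>

definition beta_norm :: "real \<Rightarrow> real \<Rightarrow> nat \<Rightarrow> real" where
  "beta_norm a b l = fact l * pochhammer (a + 1) l * (real l + a + b + 1) /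
     (pochhammer (b + 1) l * pochhammer (a + b + 2) l * (2 * real l + a + b + 1))"

context
  fixes a b :: real
  assumes a: "a > -1" and b: "b > -1"
begin

lemma beta_functional_add:
  "beta_functional a b (p + q) = beta_functional a b p + beta_functional a b q"
  using set_integral_add(2)[OF set_integrable_beta[OF a b, of p] set_integrable_beta[OF a b, of q]]
  by (simp add: beta_functional_def distrib_right)

lemma beta_functional_smult: "beta_functional a b (smult c p) = c * beta_functional a b p"
  by (simp add: beta_functional_def mult.assoc)

lemma beta_functional_diff:
  "beta_functional a b (p - q) = beta_functional a b p - beta_functional a b q"
  using beta_functional_add[of p "smult (-1) q"] beta_functional_smult[of "-1" q] by simp

lemma beta_functional_0: "beta_functional a b 0 = 0"
  by (simp add: beta_functional_def)

lemma beta_functional_sum: "beta_functional a b (\<Sum>i\<in>A. p i) = (\<Sum>i\<in>A. beta_functional a b (p i))"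
  by (induction A rule: infinite_finite_induct) (simp_all add: beta_functional_add beta_functional_0)

lemma beta_functional_moment:
  "beta_functional a b (monom 1 n * [:1, -1:] ^ i) = Beta (a + 1 + real n) (b + 1 + real i)"
proof -
  have "((\<lambda>t. t powr (a + real n) * (1 - t) powr (b + real i)) has_integral Beta (a + 1 + real n) (b + 1 + real i)) {0..1}"
    using has_integral_Beta_real[of "a + 1 + real n" "b + 1 + real i"] a b by simp
  moreover have "set_integrable lborel {0..1} (\<lambda>t. t powr (a + real n) * (1 - t) powr (b + real i))"
    using integrable_Beta[of "a + 1 + real n" "b + 1 + real i"] a b by simp
  ultimately have e: "(LINT t:{0..1}|lborel. t powr (a + real n) * (1 - t) powr (b + real i)) = Beta (a + 1 + real n) (b + 1 + real i)"
    using set_borel_integral_eq_integral(2) integral_unique by metis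
  have "AE u in lborel. u \<noteq> 0 \<and> u \<noteq> (1::real)"
    by (intro AE_conjI AE_lborel_singleton)
  then have "AE u\<in>{0..1} in lborel. poly (monom 1 n * [:1, -1:] ^ i) u * (u powr a * (1 - u) powr b)
      = u powr (a + real n) * (1 - u) powr (b + real i)"
  proof eventually_elim
    case (elim u)
    show ?case
    proof
      assume "u \<in> {0..1}"
      with elim have "0 < u" "u < 1" by auto
      then show "poly (monom 1 n * [:1, -1:] ^ i) u * (u powr a * (1 - u) powr b) = u powr (a + real n) * (1 - u) powr (b + real i)"
        by (simp add: powr_add powr_realpow poly_monom)
    qed
  qed
  then have "beta_functional a b (monom 1 n * [:1, -1:] ^ i) = (LINT t:{0..1}|lborel. t powr (a + real n) * (1 - t) powr (b + real i))"
    unfolding beta_functional_def 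
    by (intro set_lebesgue_integral_cong_AE) auto
  with e show ?thesis by simp
qed

text \<open>If the integral of the square were 0, the open interval, apart from the finitely many
  roots of \<open>p\<close>, would be a null set.\<close>

lemma beta_functional_pos:
  assumes "p \<noteq> 0" shows "beta_functional a b (p * p) > 0"
proof -
  let ?f = "\<lambda>u. indicator {0..1} u *\<^sub>R (poly (p * p) u * (u powr a * (1 - u) powr b))"
  have i: "integrable lborel ?f" using set_integrable_beta[OF a b, of "p * p"] by (simp add: set_integrable_def)
  have nn: "AE u in lborel. 0 \<le> ?f u" by (intro AE_I2) (auto simp: indicator_def)
  have "beta_functional a b (p * p) \<noteq> 0"
  proof
    assume "beta_functional a b (p * p) = 0"
    then have z: "AE u in lborel. ?f u = 0"
      using integral_nonneg_eq_0_iff_AE[OF i nn] by (simp add: beta_functional_def set_lebesgue_integral_def)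
    have "finite {u. poly p u = 0}" using assms by (rule poly_roots_finite)
    then have "{u. poly p u = 0} \<in> null_sets lborel" by (rule finite_imp_null_set_lborel)
    then have "AE u in lborel. u \<notin> {u. poly p u = 0}" by (rule AE_not_in)
    with z have "AE u in lborel. u \<notin> {0<..<1::real}"
      by eventually_elim (auto simp: indicator_def split: if_splits)
    then have "{0<..<1::real} \<in> null_sets lborel" by (simp add: AE_iff_null_sets)
    then show False by (simp add: null_sets_def)
  qed
  moreover have "beta_functional a b (p * p) \<ge> 0"
    unfolding beta_functional_def set_lebesgue_integral_def by (rule integral_nonneg_AE[OF nn])
  ultimately show ?thesis by simp
qed

lemma poly_beta_orth_1: "poly (beta_orth a b l) 1 = 1"
proof -
  have "poly (beta_orth a b l) 1 = (\<Sum>i\<in>{0..l}. if i = 0 then 1 else 0)"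
    unfolding beta_orth_def poly_sum by (intro sum.cong refl) (auto simp: poly_power)
  then show ?thesis by simp
qed

lemma degree_lin_power: "degree ([:1, -1::real:] ^ i) = i"
  by (simp add: degree_power_eq)

lemma degree_beta_orth_le: "degree (beta_orth a b l) \<le> l"
  unfolding beta_orth_def
  by (intro degree_sum_le) (auto intro!: order.trans[OF degree_smult_le] simp: degree_lin_power)

lemma pochhammer_b_pos: "pochhammer (b + 1) i > 0"
  using b by (intro pochhammer_pos) simp

lemma coeff_beta_orth: "coeff (beta_orth a b l) l = pochhammer (real l + a + b + 1) l / pochhammer (b + 1) l"
proof -
  have c: "coeff ([:1, -1::real:] ^ l) l = (-1) ^ l"
    using lead_coeff_power[of "[:1, -1::real:]" l] by (simp add: degree_lin_power)
  have "coeff (beta_orth a b l) l = (\<Sum>i\<in>{0..l}. if i = l then pochhammer (- real l) l * pochhammer (real l + a + b + 1) l /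
     (pochhammer (b + 1) l * fact l) * (-1) ^ l else 0)"
    unfolding beta_orth_def coeff_sum
    by (intro sum.cong refl) (auto simp: coeff_eq_0 degree_lin_power c)
  also have "\<dots> = pochhammer (real l + a + b + 1) l / pochhammer (b + 1) l"
    using pochhammer_same[of l, where ?'a = real] by (simp flip: power_mult_distrib)
  finally show ?thesis .
qed

text \<open>The moment of the \<open>i\<close>-th term is a Beta value whose factor
  \<open>pochhammer (b + 1) i\<close> cancels the one in the coefficient; what is left is a
  terminating hypergeometric series at 1. In the result, \<open>pochhammer (n + 1 - l) l\<close>
  contains the factor 0 exactly if \<open>n < l\<close>, and equals \<open>fact l\<close> for
  \<open>n = l\<close>.\<close>

lemma beta_functional_monom_orth:
  "beta_functional a b (monom 1 n * beta_orth a b l) =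
     Beta (a + 1 + real n) (b + 1) * pochhammer (real n + 1 - real l) l / pochhammer (a + b + real n + 2) l"
proof -
  have p: "pochhammer (a + b + real n + 2) i \<noteq> 0" for i
    using a b by (intro pochhammer_pos[THEN less_imp_neq, THEN not_sym]) simp
  have "beta_functional a b (monom 1 n * beta_orth a b l) = (\<Sum>i\<in>{0..l}. pochhammer (- real l) i * pochhammer (real l + a + b + 1) i /
     (pochhammer (b + 1) i * fact i) * Beta (a + 1 + real n) (b + 1 + real i))"
    unfolding beta_orth_def sum_distrib_left mult_smult_right beta_functional_sum beta_functional_smult
      beta_functional_moment ..
  also have "\<dots> = (\<Sum>i\<in>{0..l}. Beta (a + 1 + real n) (b + 1) * (pochhammer (real l + a + b + 1) i * pochhammer (- real l) i /
     (fact i * pochhammer (a + b + real n + 2) i)))"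
  proof (intro sum.cong refl)
    fix i
    have e: "a + 1 + real n + (b + 1) = a + b + real n + 2" by simp
    have "Beta (a + 1 + real n) (b + 1 + real i) = Beta (a + 1 + real n) (b + 1) * pochhammer (b + 1) i / pochhammer (a + b + real n + 2) i"
      unfolding e[symmetric] using a b by (intro Beta_add_nat) auto
    then show "pochhammer (- real l) i * pochhammer (real l + a + b + 1) i /
     (pochhammer (b + 1) i * fact i) * Beta (a + 1 + real n) (b + 1 + real i) = Beta (a + 1 + real n) (b + 1) * (pochhammer (real l + a + b + 1) i * pochhammer (- real l) i /
     (fact i * pochhammer (a + b + real n + 2) i))"
      using pochhammer_b_pos[of i] p[of i] by (simp add: field_simps)
  qed
  also have "\<dots> = Beta (a + 1 + real n) (b + 1) * (pochhammer (a + b + real n + 2 - (real l + a + b + 1)) l / pochhammer (a + b + real n + 2) l)"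
  proof -
    have "\<forall>i\<in>{0..<l}. a + b + real n + 2 \<noteq> - of_nat i" using a b by (auto intro!: less_imp_neq[THEN not_sym])
    from Vandermonde_pochhammer[OF this, of "real l + a + b + 1"]
    show ?thesis by (simp only: of_nat_fact flip: sum_distrib_left)
  qed
  also have "a + b + real n + 2 - (real l + a + b + 1) = real n + 1 - real l" by simp
  finally show ?thesis by simp
qed

lemma beta_functional_orth:
  assumes "degree q < l"
  shows "beta_functional a b (q * beta_orth a b l) = 0"
proof -
  have z: "beta_functional a b (monom 1 n * beta_orth a b l) = 0" if "n < l" for n
  proof -
    have "real n + 1 - real l = - of_nat (l - 1 - n)" using that by (simp add: of_nat_diff)
    moreover have "pochhammer (- of_nat (l - 1 - n) :: real) l = 0"
      using that by (subst pochhammer_of_nat_eq_0_iff) auto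
    ultimately show ?thesis unfolding beta_functional_monom_orth by simp
  qed
  have "q * beta_orth a b l = (\<Sum>i\<le>degree q. smult (coeff q i) (monom 1 i * beta_orth a b l))"
    by (subst (1) poly_as_sum_of_monoms[of q, symmetric])
       (simp add: sum_distrib_right smult_monom flip: mult_smult_left)
  then have "beta_functional a b (q * beta_orth a b l) = (\<Sum>i\<le>degree q. coeff q i * beta_functional a b (monom 1 i * beta_orth a b l))"
    by (simp only: beta_functional_sum beta_functional_smult)
  then show ?thesis using assms z by simp
qed

context
  assumes ab: "a + b + 1 > 0"
begin

lemma coeff_beta_orth_pos: "coeff (beta_orth a b l) l > 0"
  unfolding coeff_beta_orth using ab b by (intro divide_pos_pos pochhammer_pos) auto

lemma degree_beta_orth: "degree (beta_orth a b l) = l"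
  using degree_beta_orth_le[of l] le_degree[of "beta_orth a b l" l] coeff_beta_orth_pos[of l] by simp

text \<open>Subtracting the multiple with the same leading coefficient leaves a remainder of lower
  degree that is orthogonal to itself. Expressing the multiple by the value at 1 is what later
  identifies a slice from its value at \<open>t = 1\<close>.\<close>

lemma beta_orth_unique:
  assumes d: "degree p \<le> l" and o: "\<And>q. degree q < l \<Longrightarrow> beta_functional a b (p * q) = 0"
  shows "p = smult (poly p 1) (beta_orth a b l)"
proof -
  define k where "k = coeff p l / coeff (beta_orth a b l) l"
  define r where "r = p - smult k (beta_orth a b l)"
  have "degree r \<le> l" unfolding r_def using d degree_beta_orth_le
    by (intro degree_diff_le) (auto intro: order.trans[OF degree_smult_le])
  moreover have "coeff r l = 0" using coeff_beta_orth_pos[of l] by (simp add: r_def k_def)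
  ultimately have r: "r = 0 \<or> degree r < l" by (rule eq_zero_or_degree_less)
  have "r = 0"
  proof (rule ccontr)
    assume n: "r \<noteq> 0"
    with r have d: "degree r < l" by simp
    have "r * r = (p - smult k (beta_orth a b l)) * r" by (simp only: r_def)
    also have "\<dots> = p * r - smult k (r * beta_orth a b l)" by (simp only: left_diff_distrib mult_smult_left mult.commute[of "beta_orth a b l" r])
    finally have "beta_functional a b (r * r) = beta_functional a b (p * r) - k * beta_functional a b (r * beta_orth a b l)"
      by (simp add: beta_functional_diff beta_functional_smult)
    also have "\<dots> = 0" using o[OF d] beta_functional_orth[OF d] by simp
    finally show False using beta_functional_pos[OF n] by simp
  qed
  then have "p = smult k (beta_orth a b l)" by (simp add: r_def)
  then show ?thesis by (metis mult.right_neutral poly_beta_orth_1 poly_smult)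
qed

text \<open>By orthogonality one of the two factors may be replaced by its leading term, and the
  pairing with \<open>u ^ l\<close> is the case \<open>n = l\<close> of
  \<open>beta_functional_monom_orth\<close>.\<close>

lemma beta_functional_norm:
  "beta_functional a b (beta_orth a b l * beta_orth a b l) = beta_norm a b l * beta_functional a b 1"
proof -
  define c where "c = coeff (beta_orth a b l) l"
  define s where "s = real l + a + b + 1"
  have s: "s > 0" using ab by (simp add: s_def)
  define r where "r = beta_orth a b l - monom c l"
  have "degree r \<le> l" unfolding r_def using degree_beta_orth_le
    by (intro degree_diff_le) (auto intro: degree_monom_le)
  moreover have "coeff r l = 0" by (simp add: r_def c_def)
  ultimately have r: "r = 0 \<or> degree r < l" by (rule eq_zero_or_degree_less)
  then have "beta_functional a b (r * beta_orth a b l) = 0"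
    using beta_functional_orth[of r l] beta_functional_0 by auto
  moreover have "beta_orth a b l * beta_orth a b l = r * beta_orth a b l + smult c (monom 1 l * beta_orth a b l)"
    by (simp add: r_def left_diff_distrib smult_monom flip: mult_smult_left)
  ultimately have "beta_functional a b (beta_orth a b l * beta_orth a b l) = c * beta_functional a b (monom 1 l * beta_orth a b l)"
    by (simp add: beta_functional_add beta_functional_smult)
  also have "\<dots> = c * Beta (a + 1 + real l) (b + 1) * fact l / pochhammer (s + 1) l"
    by (simp add: beta_functional_monom_orth pochhammer_fact s_def add_ac)
  also have "Beta (a + 1 + real l) (b + 1) = Beta (a + 1) (b + 1) * pochhammer (a + 1) l / pochhammer (a + b + 2) l"
    using Beta_add_nat[of "b + 1" "a + 1" l] a b by (simp add: Beta_commute add_ac)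
  also have "c = pochhammer s l / pochhammer (b + 1) l" by (simp add: c_def coeff_beta_orth s_def)
  \<comment> \<open>Shifting the start of the rising factorial makes it cancel against
    \<open>pochhammer (s + 1) l\<close> and leaves \<open>s / (s + l)\<close>, where
    \<open>s + l\<close> is \<open>2 * l + a + b + 1\<close>.\<close>
  also have "pochhammer s l = s * pochhammer (s + 1) l / (s + real l)"
    using pochhammer_rec[of s l] pochhammer_rec'[of s l] s by (simp add: field_simps)
  also have "Beta (a + 1) (b + 1) = beta_functional a b 1"
    using beta_functional_moment[of 0 0] by (simp add: monom_0 one_pCons)
  finally have e: "beta_functional a b (beta_orth a b l * beta_orth a b l) =
    s * pochhammer (s + 1) l / (s + real l) / pochhammer (b + 1) l *
    (beta_functional a b 1 * pochhammer (a + 1) l / pochhammer (a + b + 2) l) * fact l / pochhammer (s + 1) l" .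
  have "pochhammer (s + 1) l > 0" using s by (intro pochhammer_pos) simp
  moreover have "2 * real l + a + b + 1 = s + real l" by (simp add: s_def)
  ultimately show ?thesis
    unfolding e beta_norm_def s_def[symmetric] by (simp add: ac_simps)
qed

end
end


section \<open>Jacobi polynomials on [-1, 1]\<close>

definition jac :: "real \<Rightarrow> real \<Rightarrow> nat \<Rightarrow> real poly" where
  "jac \<alpha> \<beta> l = pcompose (beta_orth \<beta> \<alpha> l) [:1/2, 1/2:]"

definition jac_functional :: "real \<Rightarrow> real \<Rightarrow> real poly \<Rightarrow> real" where
  "jac_functional \<alpha> \<beta> p = (LINT t:{-1..1}|lebesgue. poly p t * jacobi_weight \<alpha> \<beta> t)"

lemma measurable_jacobi_weight [measurable]: "jacobi_weight \<alpha> \<beta> \<in> borel_measurable borel"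
  unfolding jacobi_weight_def by measurable

text \<open>Under \<open>t = 2 * u - 1\<close> the factor \<open>1 + t\<close> becomes
  \<open>2 * u\<close> and \<open>1 - t\<close> becomes \<open>2 * (1 - u)\<close>, which is why the
  two parameters change places. The weight contributes \<alpha> + \<beta> to the exponent of 2, and
  \<open>dt\<close> contributes 1.\<close>

lemma jac_functional_eq:
  "jac_functional \<alpha> \<beta> p = 2 powr (\<alpha> + \<beta> + 1) * beta_functional \<beta> \<alpha> (pcompose p [:-1, 2:])"
proof -
  have "jac_functional \<alpha> \<beta> p = (\<integral>t. indicator {-1..1} t * (poly p t * jacobi_weight \<alpha> \<beta> t) \<partial>lborel)"
    unfolding jac_functional_def
    by (subst set_lebesgue_eq_lborel) (auto simp: set_lebesgue_integral_def)
  also have "\<dots> = 2 * (\<integral>u. indicator {-1..1} (-1 + 2 * u) * (poly p (-1 + 2 * u) * jacobi_weight \<alpha> \<beta> (-1 + 2 * u)) \<partial>lborel)"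
    by (subst lborel_integral_real_affine[where t = "-1" and c = 2]) auto
  also have "\<dots> = 2 * (\<integral>u. 2 powr (\<alpha> + \<beta>) * (indicator {0..1} u * (poly (pcompose p [:-1, 2:]) u * (u powr \<beta> * (1 - u) powr \<alpha>))) \<partial>lborel)"
  proof -
    have "indicator {-1..1} (-1 + 2 * u) * (poly p (-1 + 2 * u) * jacobi_weight \<alpha> \<beta> (-1 + 2 * u)) =
       2 powr (\<alpha> + \<beta>) * (indicator {0..1} u * (poly (pcompose p [:-1, 2:]) u * (u powr \<beta> * (1 - u) powr \<alpha>)))" for u :: real
    proof (cases "u \<in> {0..1}")
      case True
      have "jacobi_weight \<alpha> \<beta> (-1 + 2 * u) = (2 * (1 - u)) powr \<alpha> * (2 * u) powr \<beta>"
        by (simp add: jacobi_weight_def algebra_simps)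
      also have "\<dots> = 2 powr (\<alpha> + \<beta>) * (u powr \<beta> * (1 - u) powr \<alpha>)"
        using True powr_mult[of 2 "1 - u" \<alpha>] powr_mult[of 2 u \<beta>] by (simp only: powr_add ac_simps)
      finally show ?thesis using True by (simp add: poly_pcompose mult.commute)
    qed (auto simp: indicator_def)
    then show ?thesis by simp
  qed
  finally show ?thesis
    by (simp add: beta_functional_def set_lebesgue_integral_def powr_add)
qed

lemma pcompose_jac: "pcompose (jac \<alpha> \<beta> l) [:-1, 2:] = beta_orth \<beta> \<alpha> l"
proof -
  have "pcompose [:1/2, 1/2:] [:-1, 2::real:] = [:0, 1:]" by (simp add: pcompose_pCons)
  then show ?thesis unfolding jac_def by (metis pcompose_assoc pcompose_idR)
qed

lemma pcompose_lin_inverse: "pcompose (pcompose p [:-1, 2:]) [:1/2, 1/2::real:] = p"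
proof -
  have "pcompose [:-1, 2::real:] [:1/2, 1/2:] = [:0, 1:]" by (simp add: pcompose_pCons)
  then show ?thesis by (metis pcompose_assoc pcompose_idR)
qed

context
  fixes \<alpha> \<beta> :: real
  assumes \<alpha>: "\<alpha> > -1" and \<beta>: "\<beta> > -1" and \<alpha>\<beta>: "\<alpha> + \<beta> + 1 > 0"
begin

lemma degree_jac: "degree (jac \<alpha> \<beta> l) = l"
  using \<alpha> \<beta> \<alpha>\<beta> by (simp add: jac_def degree_beta_orth degree_pcompose)

lemma poly_jac_1: "poly (jac \<alpha> \<beta> l) 1 = 1"
  by (simp add: jac_def poly_pcompose poly_beta_orth_1[OF \<beta> \<alpha>])

lemma lead_coeff_jac: "lead_coeff (jac \<alpha> \<beta> l) > 0"
  using coeff_beta_orth_pos[of \<beta> \<alpha> l] \<alpha> \<beta> \<alpha>\<beta>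
  by (simp add: jac_def lead_coeff_comp degree_beta_orth)

lemma jac_functional_orth: "degree q < l \<Longrightarrow> jac_functional \<alpha> \<beta> (q * jac \<alpha> \<beta> l) = 0"
  by (simp add: jac_functional_eq pcompose_mult pcompose_jac beta_functional_orth[OF \<beta> \<alpha>] degree_pcompose)

lemma jac_functional_norm:
  "jac_functional \<alpha> \<beta> (jac \<alpha> \<beta> l * jac \<alpha> \<beta> l) = beta_norm \<beta> \<alpha> l * jac_functional \<alpha> \<beta> 1"
  using \<alpha>\<beta> by (simp add: jac_functional_eq pcompose_mult pcompose_jac beta_functional_norm[OF \<beta> \<alpha>] pcompose_1)

lemma jac_functional_pos: "p \<noteq> 0 \<Longrightarrow> jac_functional \<alpha> \<beta> (p * p) > 0"
proof -
  assume "p \<noteq> 0"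
  then have "pcompose p [:-1, 2:] \<noteq> 0" using pcompose_lin_inverse[of p] by (metis pcompose_0)
  from beta_functional_pos[OF \<beta> \<alpha> this] show ?thesis by (simp add: jac_functional_eq pcompose_mult)
qed

lemma jac_functional_smult: "jac_functional \<alpha> \<beta> (smult c p) = c * jac_functional \<alpha> \<beta> p"
  by (simp add: jac_functional_def mult.assoc)

lemma jac_unique:
  assumes d: "degree p \<le> l" and o: "\<And>q. degree q < l \<Longrightarrow> jac_functional \<alpha> \<beta> (p * q) = 0"
  shows "p = smult (poly p 1) (jac \<alpha> \<beta> l)"
proof -
  let ?p = "pcompose p [:-1, 2:]"
  have "?p = smult (poly ?p 1) (beta_orth \<beta> \<alpha> l)"
  proof (rule beta_orth_unique[OF \<beta> \<alpha>])
    show "\<beta> + \<alpha> + 1 > 0" using \<alpha>\<beta> by simp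
    show "degree ?p \<le> l" using d by (simp add: degree_pcompose)
    fix q :: "real poly" assume q: "degree q < l"
    have "jac_functional \<alpha> \<beta> (p * pcompose q [:1/2, 1/2:]) = 0" using q by (intro o) (simp add: degree_pcompose)
    moreover have "pcompose (pcompose q [:1/2, 1/2:]) [:-1, 2:] = q"
    proof -
      have "pcompose [:1/2, 1/2:] [:-1, 2::real:] = [:0, 1:]" by (simp add: pcompose_pCons)
      then show ?thesis by (metis pcompose_assoc pcompose_idR)
    qed
    ultimately show "beta_functional \<beta> \<alpha> (?p * q) = 0"
      by (simp add: jac_functional_eq pcompose_mult)
  qed
  then have "pcompose ?p [:1/2, 1/2:] = pcompose (smult (poly ?p 1) (beta_orth \<beta> \<alpha> l)) [:1/2, 1/2:]" by (rule arg_cong)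
  then show ?thesis
    by (simp only: pcompose_lin_inverse pcompose_smult jac_def[symmetric]) (simp add: poly_pcompose)
qed

lemma beta_norm_pos: "beta_norm \<beta> \<alpha> l > 0"
  using \<alpha> \<beta> \<alpha>\<beta> unfolding beta_norm_def
  by (intro divide_pos_pos mult_pos_pos pochhammer_pos) auto

lemma jacobi_inner_eq: "jacobi_inner \<alpha> \<beta> p q = jac_functional \<alpha> \<beta> (p * q) / jac_functional \<alpha> \<beta> 1"
  by (simp add: jacobi_inner_def jac_functional_def)

text \<open>Orthogonality determines the polynomial up to a factor, the norm determines the square
  of the factor, and the positive leading coefficient its sign.\<close>

lemma jacobi_orthonormal_eq:
  "jacobi_orthonormal \<alpha> \<beta> l = smult (1 / sqrt (beta_norm \<beta> \<alpha> l)) (jac \<alpha> \<beta> l)"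
proof -
  have J1: "jac_functional \<alpha> \<beta> 1 > 0" using jac_functional_pos[of 1] by simp
  let ?N = "beta_norm \<beta> \<alpha> l"
  have N: "?N > 0" by (rule beta_norm_pos)
  have norm: "jacobi_inner \<alpha> \<beta> (smult c (jac \<alpha> \<beta> l)) (smult c (jac \<alpha> \<beta> l)) = c\<^sup>2 * ?N" for c
    using J1 by (simp add: jacobi_inner_eq jac_functional_smult jac_functional_norm power2_eq_square)
  show ?thesis unfolding jacobi_orthonormal_def
  proof (rule the_equality, goal_cases)
    case 1
    have "jacobi_inner \<alpha> \<beta> (smult (1 / sqrt ?N) (jac \<alpha> \<beta> l)) q = 0" if "degree q < l" for q
      using jac_functional_orth[OF that] by (simp add: jacobi_inner_eq jac_functional_smult mult.commute)
    moreover have "jacobi_inner \<alpha> \<beta> (smult (1 / sqrt ?N) (jac \<alpha> \<beta> l)) (smult (1 / sqrt ?N) (jac \<alpha> \<beta> l)) = 1"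
      using N by (simp only: norm) (simp add: power_divide)
    ultimately show ?case using N lead_coeff_jac[of l] degree_jac[of l] by simp
  next
    case (2 p)
    then have o: "jac_functional \<alpha> \<beta> (p * q) = 0" if "degree q < l" for q
      using that J1 by (auto simp: jacobi_inner_eq)
    define c where "c = poly p 1"
    have p: "p = smult c (jac \<alpha> \<beta> l)" unfolding c_def using 2 o by (intro jac_unique) auto
    have "c\<^sup>2 * ?N = 1" using 2 norm[of c] by (simp flip: p)
    moreover have "c > 0"
    proof -
      have "lead_coeff p = c * lead_coeff (jac \<alpha> \<beta> l)" unfolding p by (rule lead_coeff_smult)
      then have "0 < c * lead_coeff (jac \<alpha> \<beta> l)" using 2 by metis
      then show ?thesis using lead_coeff_jac[of l] by (rule zero_less_mult_pos2)
    qed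
    ultimately have "c = 1 / sqrt ?N"
      using N by (metis eq_divide_eq less_imp_le less_irrefl real_sqrt_abs real_sqrt_mult real_sqrt_one abs_of_pos real_sqrt_gt_zero)
    with p show ?case by simp
  qed
qed

end

text \<open>Since \<open>1 - s\<^sup>2 = (1 - s) * (1 + s)\<close>, the weight is the Jacobi weight
  with both exponents \<open>\<gamma> - 1/2\<close>; the prescribed value at 1 is then the multiple
  of \<open>jac\<close>.\<close>

lemma gegenbauer_eq:
  assumes "\<gamma> \<ge> 1/2"
  shows "gegenbauer \<gamma> k = smult (pochhammer (2 * \<gamma>) k / fact k) (jac (\<gamma> - 1/2) (\<gamma> - 1/2) k)"
proof -
  let ?a = "\<gamma> - 1/2"
  let ?C = "pochhammer (2 * \<gamma>) k / fact k :: real"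
  have a: "?a > -1" "?a + ?a + 1 > 0" using assms by auto
  have w: "(LINT s:{-1..1}|lebesgue. poly p s * poly q s * (1 - s\<^sup>2) powr ?a) = jac_functional ?a ?a (p * q)" for p q
    unfolding jac_functional_def
  proof (intro set_lebesgue_integral_cong allI impI)
    fix s :: real assume s: "s \<in> {-1..1}"
    have "1 - s\<^sup>2 = (1 - s) * (1 + s)" by (simp add: power2_eq_square algebra_simps)
    then have "(1 - s\<^sup>2) powr ?a = jacobi_weight ?a ?a s"
      using s by (simp add: jacobi_weight_def powr_mult)
    then show "poly p s * poly q s * (1 - s\<^sup>2) powr ?a = poly (p * q) s * jacobi_weight ?a ?a s" by simp
  qed simp
  have C: "?C > 0" using assms by (intro divide_pos_pos pochhammer_pos) auto
  show ?thesis unfolding gegenbauer_def w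
  proof (rule the_equality, goal_cases)
    case 1
    have "jac_functional ?a ?a (smult ?C (jac ?a ?a k) * q) = 0" if "degree q < k" for q
      using jac_functional_orth[OF a(1) a(1) a(2) that] 
      by (simp add: jac_functional_smult[OF a(1) a(1) a(2)] mult.commute)
    moreover have "degree (smult ?C (jac ?a ?a k)) = k"
      using C degree_jac[OF a(1) a(1) a(2)] by (metis degree_smult_eq less_irrefl)
    ultimately show ?case using poly_jac_1[OF a(1) a(1) a(2)] by simp
  next
    case (2 p)
    then show ?case using jac_unique[OF a(1) a(1) a(2), of p k] by auto
  qed
qed

section \<open>Discrete orthogonality on equidistant nodes\<close>

text \<open>A geometric sum whose ratio is an \<open>N\<close>-th root of unity different from
  1.\<close>

lemma sum_cis_roots:
  fixes n :: int
  assumes N: "N > 0" and n: "\<not> int N dvd n"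
  shows "(\<Sum>\<nu><N. cis (of_int n * (\<phi> + 2 * pi * real \<nu> / real N))) = 0"
proof -
  define w where "w = cis (of_int n * (2 * pi / real N))"
  have "w \<noteq> 1"
  proof
    assume "w = 1"
    then have "cos (of_int n * (2 * pi / real N)) = 1" by (simp add: w_def complex_eq_iff)
    then obtain k :: int where "of_int n * (2 * pi / real N) = of_int k * 2 * pi"
      unfolding cos_one_2pi_int by auto
    then have "of_int n = (of_int (k * int N) :: real)" using N by (simp add: field_simps)
    then have "n = k * int N" by linarith
    with n show False by simp
  qed
  moreover have "w ^ N = 1"
  proof -
    have "w ^ N = cis (2 * pi * of_int n)" using N unfolding w_def Complex.DeMoivre by (simp add: field_simps)
    then show ?thesis by simp
  qed
  ultimately have "(\<Sum>\<nu><N. w ^ \<nu>) = 0" by (simp add: geometric_sum)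
  moreover have "cis (of_int n * (\<phi> + 2 * pi * real \<nu> / real N)) = cis (of_int n * \<phi>) * w ^ \<nu>" for \<nu>
    unfolding w_def Complex.DeMoivre cis_mult by (simp add: algebra_simps)
  ultimately show ?thesis by (simp flip: sum_distrib_left)
qed

text \<open>Product-to-sum formulas reduce everything to the sum and the difference of the
  frequencies. Nondivisibility is a hypothesis because it is met in two ways: by taking
  \<open>N\<close> large when averaging over rotations, and by parity at the nodes of the theorem.
  The phase \<phi> serves the first use.\<close>

lemma sum_S_trig_mult:
  assumes N: "N > 0"
    and s: "j + j' \<noteq> 0 \<Longrightarrow> \<not> int N dvd int j + int j'" and d: "j \<noteq> j' \<Longrightarrow> \<not> int N dvd int j - int j'"
    and \<epsilon>: "\<epsilon> = 0 \<or> \<epsilon> = 1 \<and> 0 < j" "\<epsilon>' = 0 \<or> \<epsilon>' = 1 \<and> 0 < j'"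
  shows "(\<Sum>\<nu><N. S_trig j \<epsilon> (\<phi> + 2 * pi * real \<nu> / real N) * S_trig j' \<epsilon>' (\<phi> + 2 * pi * real \<nu> / real N)) =
    (if j = j' \<and> \<epsilon> = \<epsilon>' then real N * (if j = 0 then 1 else 1/2) else 0)"
proof -
  let ?x = "\<lambda>\<nu>. \<phi> + 2 * pi * real \<nu> / real N"
  define C where "C n = (\<Sum>\<nu><N. cos (of_int n * ?x \<nu>))" for n :: int
  define S where "S n = (\<Sum>\<nu><N. sin (of_int n * ?x \<nu>))" for n :: int
  have z: "C n = 0" "S n = 0" if "\<not> int N dvd n" for n
    using sum_cis_roots[OF N that, of \<phi>] by (simp_all add: C_def S_def complex_eq_iff)
  have z0: "C 0 = real N" "S 0 = 0" by (simp_all add: C_def S_def)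
  have cd: "C (int j - int j') = (if j = j' then real N else 0)" and sd: "S (int j - int j') = 0"
    using z[OF d] z0 by (cases "j = j'"; simp)+
  have cs: "C (int j + int j') = (if j + j' = 0 then real N else 0)" and ss: "S (int j + int j') = 0"
  proof -
    have "C (int j + int j') = (if j + j' = 0 then real N else 0) \<and> S (int j + int j') = 0"
    proof (cases "j + j' = 0")
      case True
      then have "int j + int j' = 0" by linarith
      with True z0 show ?thesis by (simp only: if_True simp_thms)
    next
      case False
      from z[OF s[OF False]] False show ?thesis by (simp only: if_False simp_thms)
    qed
    then show "C (int j + int j') = (if j + j' = 0 then real N else 0)" "S (int j + int j') = 0" by blast+
  qed
  have e: "real j * x - real j' * x = of_int (int j - int j') * x" "real j * x + real j' * x = of_int (int j + int j') * x" for x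
    by (simp_all add: algebra_simps)
  have cc: "(\<Sum>\<nu><N. cos (real j * ?x \<nu>) * cos (real j' * ?x \<nu>)) = (C (int j - int j') + C (int j + int j')) / 2"
    unfolding cos_times_cos e C_def by (simp only: sum.distrib[symmetric] sum_divide_distrib)
  have si: "(\<Sum>\<nu><N. sin (real j * ?x \<nu>) * sin (real j' * ?x \<nu>)) = (C (int j - int j') - C (int j + int j')) / 2"
    unfolding sin_times_sin e C_def by (simp only: sum_subtractf[symmetric] sum_divide_distrib)
  have sc: "(\<Sum>\<nu><N. sin (real j * ?x \<nu>) * cos (real j' * ?x \<nu>)) = (S (int j + int j') + S (int j - int j')) / 2"
    unfolding sin_times_cos e S_def by (simp only: sum.distrib[symmetric] sum_divide_distrib)
  have cs2: "(\<Sum>\<nu><N. cos (real j * ?x \<nu>) * sin (real j' * ?x \<nu>)) = (S (int j + int j') - S (int j - int j')) / 2"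
    unfolding cos_times_sin e S_def by (simp only: sum_subtractf[symmetric] sum_divide_distrib)
  show ?thesis
    using \<epsilon> by (elim disjE conjE) (simp_all add: S_trig_def cc si sc cs2 cd sd cs ss)
qed

section \<open>The basis of the space of orthogonal polynomials\<close>

lemma harm_polar: "harm j \<epsilon> (x, y) = sqrt (x\<^sup>2 + y\<^sup>2) ^ j * S_trig j \<epsilon> (Arg (Complex x y))"
proof -
  have "Complex x y = rcis (sqrt (x\<^sup>2 + y\<^sup>2)) (Arg (Complex x y))"
    by (metis rcis_cmod_Arg complex_norm)
  then have "Complex x y ^ j = rcis (sqrt (x\<^sup>2 + y\<^sup>2) ^ j) (real j * Arg (Complex x y))"
    by (metis DeMoivre2)
  then show ?thesis by (simp add: harm_def S_trig_def)
qed

lemma harm_rot: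
  "harm j \<epsilon> (rot \<theta> (x, y)) = sqrt (x\<^sup>2 + y\<^sup>2) ^ j * S_trig j \<epsilon> (Arg (Complex x y) + \<theta>)"
proof -
  have "Complex (fst (rot \<theta> (x, y))) (snd (rot \<theta> (x, y))) = cis \<theta> * Complex x y"
    by (simp add: rot_def complex_eq_iff algebra_simps)
  moreover have "Complex x y = rcis (sqrt (x\<^sup>2 + y\<^sup>2)) (Arg (Complex x y))"
    by (metis rcis_cmod_Arg complex_norm)
  ultimately have "Complex (fst (rot \<theta> (x, y))) (snd (rot \<theta> (x, y))) = rcis (sqrt (x\<^sup>2 + y\<^sup>2)) (Arg (Complex x y) + \<theta>)"
    by (metis add.commute cis_rcis_eq mult.left_neutral rcis_mult)
  then have "Complex (fst (rot \<theta> (x, y))) (snd (rot \<theta> (x, y))) ^ j = rcis (sqrt (x\<^sup>2 + y\<^sup>2) ^ j) (real j * (Arg (Complex x y) + \<theta>))"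
    by (simp only: DeMoivre2)
  then show ?thesis by (simp add: harm_def S_trig_def)
qed

lemma harm_circle: "harm j \<epsilon> (cos \<xi>, sin \<xi>) = S_trig j \<epsilon> \<xi>"
proof -
  have "Complex (cos \<xi>) (sin \<xi>) = cis \<xi>" by (simp add: complex_eq_iff)
  then show ?thesis by (simp add: harm_def S_trig_def Complex.DeMoivre)
qed

text \<open>The harmonic absorbs the power of the radius together with the angular factor, which
  exhibits the basis function as a polynomial.\<close>

lemma basis_fun_eq:
  "basis_fun \<mu> k l \<epsilon> z = h_const \<mu> l k *
     poly (jacobi_orthonormal (\<mu> - 1/2) (real (k - 2 * l)) l) (2 * nsq z - 1) * harm (k - 2 * l) \<epsilon> z"
  by (cases z) (simp add: basis_fun_def harm_polar nsq_def Let_def)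

lemma borel_measurable_lebesgue_on:
  fixes f :: "'a::euclidean_space \<Rightarrow> real"
  assumes "f \<in> borel_measurable borel" shows "f \<in> borel_measurable (lebesgue_on S)"
  using assms by (intro measurable_restrict_space1 measurable_completion) simp

lemma W_eq_nsq: "W \<mu> z = (1 - nsq z) powr (\<mu> - 1/2)"
  by (simp add: W_def nsq_def case_prod_unfold diff_diff_eq)

lemma W_nonneg: "W \<mu> z \<ge> 0"
  by (simp add: W_def case_prod_unfold)

lemma measurable_W [measurable]: "W \<mu> \<in> borel_measurable borel"
  unfolding W_eq_nsq[abs_def] by measurable

lemma measurable_poly2: "Q \<in> poly2_le n \<Longrightarrow> Q \<in> borel_measurable borel"
  using poly2_le_continuous borel_measurable_continuous_onI by blast

text \<open>The test polynomials of degree strictly below \<open>k\<close>. The case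
  \<open>k = 0\<close> is separate because \<open>k - 1\<close> would be truncated to 0 and admit
  the constants.\<close>

definition low :: "nat \<Rightarrow> (real \<times> real \<Rightarrow> real) set" where
  "low k = (if k = 0 then {\<lambda>_. 0} else poly2_le (k - 1))"

lemma low_iff: "P \<in> low k \<longleftrightarrow> P = (\<lambda>_. 0) \<or> (\<exists>n<k. P \<in> poly2_le n)"
proof (cases k)
  case (Suc k')
  then show ?thesis using poly2_le_zero[of k'] poly2_le_mono
    by (auto simp: low_def less_Suc_eq_le)
qed (simp add: low_def)

lemma low_add: "f \<in> low k \<Longrightarrow> g \<in> low k \<Longrightarrow> (\<lambda>z. f z + g z) \<in> low k"
  by (auto simp: low_def poly2_le_add split: if_splits)

lemma low_scale: "f \<in> low k \<Longrightarrow> (\<lambda>z. a * f z) \<in> low k"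
  by (auto simp: low_def poly2_le_scale split: if_splits)

lemma low_subset: "P \<in> low k \<Longrightarrow> P \<in> poly2_le k"
  using poly2_le_zero poly2_le_mono by (auto simp: low_iff dest!: less_imp_le)

text \<open>Along the line through the origin and \<open>z\<close>, \<open>P\<close> is a polynomial
  in one variable with infinitely many roots near 0, so it also vanishes at parameter 1.\<close>

lemma poly2_eq_0_on_ball:
  assumes P: "P \<in> poly2_le n" and z: "\<And>z. z \<in> ball (0, 0) 1 \<Longrightarrow> P z = 0"
  shows "P = (\<lambda>_. 0)"
proof
  fix z :: "real \<times> real"
  have "\<exists>q. \<forall>t. P (t * fst z, t * snd z) = poly q t"
    using P
  proof (induction rule: poly2_le_induct)
    case zero show ?case by (auto intro: exI[of _ 0])
  next
    case (add f g)
    then show ?case by (metis poly_add)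
  next
    case (scale a f)
    then show ?case by (metis poly_smult)
  next
    case (monom i j)
    have "(t * fst z) ^ i * (t * snd z) ^ j = poly (monom (fst z ^ i * snd z ^ j) (i + j)) t" for t
      by (simp add: poly_monom power_mult_distrib power_add)
    then show ?case by auto
  qed
  then obtain q where q: "\<And>t. P (t * fst z, t * snd z) = poly q t" by blast
  define e where "e = 1 / (norm z + 1)"
  have e: "e > 0" by (simp add: e_def add_nonneg_pos)
  have "poly q t = 0" if t: "0 < t" "t < e" for t
  proof -
    have "norm (t *\<^sub>R z) < 1"
    proof -
      have "t * norm z \<le> t * (norm z + 1)" using t by simp
      also have "\<dots> < e * (norm z + 1)" using t by (intro mult_strict_right_mono) (auto intro: add_nonneg_pos)
      also have "\<dots> = 1" using norm_ge_zero[of z] by (simp add: e_def add_nonneg_eq_0_iff)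
      finally show ?thesis using t by simp
    qed
    then have "(t * fst z, t * snd z) \<in> ball (0, 0) 1"
      by (cases z) (simp add: dist_norm norm_minus_commute norm_Pair power_mult_distrib)
    then show ?thesis using z q by metis
  qed
  then have "{0<..<e} \<subseteq> {t. poly q t = 0}" by auto
  moreover have "infinite {0<..<e}" using e by (simp add: infinite_Ioo)
  ultimately have "q = 0" using poly_roots_finite finite_subset by blast
  then show "P z = 0" using q[of 1] by simp
qed

section \<open>The weighted inner product and the spaces of orthogonal polynomials\<close>

locale disc_weight =
  fixes \<mu> :: real
  assumes \<mu>: "\<mu> \<ge> 0"
begin

text \<open>Uniform distribution of \<open>nsq\<close>, followed by \<open>t = 2 * nsq - 1\<close>,
  turns \<open>nsq ^ j\<close> into the Jacobi factor \<open>(1 + t) ^ j\<close> up to a power of 2.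
  Two harmonics of frequency \<open>j\<close> produce just this \<open>nsq ^ j\<close>, whence the
  second Jacobi parameter \<open>k - 2 * l\<close> of the basis.\<close>

lemma set_integrable_radial:
  "set_integrable lebesgue B2 (\<lambda>z. poly q (2 * nsq z - 1) * nsq z ^ j * W \<mu> z)"
  and integral_radial:
  "(LINT z:B2|lebesgue. poly q (2 * nsq z - 1) * nsq z ^ j * W \<mu> z)
     = pi / 2 powr (\<mu> + 1/2 + real j) * jac_functional (\<mu> - 1/2) (real j) q"
proof -
  define g where "g u = poly q (2 * u - 1) * u ^ j * (1 - u) powr (\<mu> - 1/2)" for u
  have gm[measurable]: "g \<in> borel_measurable borel" unfolding g_def by measurable
  have gW: "(\<lambda>z. poly q (2 * nsq z - 1) * nsq z ^ j * W \<mu> z) = (\<lambda>z. g (nsq z))"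
    by (simp add: g_def W_eq_nsq)
  let ?b = "\<lambda>u. poly (pcompose q [:-1, 2:]) u * (u powr real j * (1 - u) powr (\<mu> - 1/2))"
  \<comment> \<open>At \<open>u = 0\<close> and \<open>j = 0\<close> the two forms differ:
    \<open>0 ^ 0\<close> is 1 while \<open>0 powr 0\<close> is 0.\<close>
  have "AE u in lborel. u \<noteq> (0::real)" by (rule AE_lborel_singleton)
  then have ae: "AE u in lborel. u \<in> {0..1} \<longrightarrow> g u = ?b u"
    by eventually_elim (auto simp: g_def poly_pcompose powr_realpow algebra_simps)
  have i: "set_integrable lborel {0..1} ?b"
    using \<mu> by (intro set_integrable_beta) auto
  then have "set_integrable lborel {0..1} g"
    using ae by (subst set_integrable_cong_AE) (auto simp: set_borel_measurable_def)
  then show "set_integrable lebesgue B2 (\<lambda>z. poly q (2 * nsq z - 1) * nsq z ^ j * W \<mu> z)"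
    unfolding gW disc_radial(2)[OF gm] .
  have "(LINT u:{0..1}|lborel. g u) = beta_functional (real j) (\<mu> - 1/2) (pcompose q [:-1, 2:])"
    unfolding beta_functional_def using ae
    by (intro set_lebesgue_integral_cong_AE) auto
  also have "\<dots> = jac_functional (\<mu> - 1/2) (real j) q / 2 powr (\<mu> + 1/2 + real j)"
    by (simp add: jac_functional_eq algebra_simps)
  finally show "(LINT z:B2|lebesgue. poly q (2 * nsq z - 1) * nsq z ^ j * W \<mu> z)
     = pi / 2 powr (\<mu> + 1/2 + real j) * jac_functional (\<mu> - 1/2) (real j) q"
    unfolding gW disc_radial(1)[OF gm] by simp
qed

lemma set_integrable_W: "set_integrable lebesgue B2 (W \<mu>)"
  using set_integrable_radial[of 1 0] by simp

lemma set_integrable_poly2_W: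
  assumes "Q \<in> poly2_le n"
  shows "set_integrable lebesgue B2 (\<lambda>z. Q z * W \<mu> z)"
proof -
  have "compact (Q ` B2)"
    using poly2_le_continuous[OF assms] by (intro compact_continuous_image) (auto intro: continuous_on_subset)
  then have "bounded (Q ` B2)" by (rule compact_imp_bounded)
  then obtain B where B: "\<And>z. z \<in> B2 \<Longrightarrow> \<bar>Q z\<bar> \<le> B"
    unfolding bounded_iff by (metis imageI real_norm_def)
  have [measurable]: "Q \<in> borel_measurable borel" "B2 \<in> sets borel"
    using measurable_poly2[OF assms] by auto
  have "set_integrable lborel B2 (\<lambda>z. B * W \<mu> z)"
    using set_integrable_W by (subst (asm) set_lebesgue_eq_lborel) auto
  then have "set_integrable lborel B2 (\<lambda>z. Q z * W \<mu> z)"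
  proof (rule set_integrable_bound)
    show "set_borel_measurable lborel B2 (\<lambda>z. Q z * W \<mu> z)"
      unfolding set_borel_measurable_def by measurable
    show "AE z in lborel. z \<in> B2 \<longrightarrow> norm (Q z * W \<mu> z) \<le> norm (B * W \<mu> z)"
    proof (intro AE_I2 impI)
      fix z assume "z \<in> B2"
      from B[OF this] show "norm (Q z * W \<mu> z) \<le> norm (B * W \<mu> z)"
        by (auto simp: abs_mult intro!: mult_right_mono)
    qed
  qed
  then show ?thesis by (subst set_lebesgue_eq_lborel) auto
qed

lemma poly2_L2: "Q \<in> poly2_le n \<Longrightarrow> Q \<in> L2_disc \<mu>"
  using set_integrable_poly2_W[OF poly2_le_mult[of Q n Q n]] measurable_poly2[of Q n]
  by (auto simp: L2_disc_def power2_eq_square intro!: borel_measurable_lebesgue_on)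

text \<open>Domination by the sum of the squares, in the measure space restricted to the disc
  because nothing is assumed of the functions outside it.\<close>

lemma L2_mult_integrable:
  assumes "f \<in> L2_disc \<mu>" "g \<in> L2_disc \<mu>"
  shows "set_integrable lebesgue B2 (\<lambda>z. f z * g z * W \<mu> z)"
proof -
  have Bs: "B2 \<in> sets lebesgue" by auto
  have i: "integrable (lebesgue_on B2) (\<lambda>z. (f z)\<^sup>2 * W \<mu> z)" "integrable (lebesgue_on B2) (\<lambda>z. (g z)\<^sup>2 * W \<mu> z)"
    and [measurable]: "f \<in> borel_measurable (lebesgue_on B2)" "g \<in> borel_measurable (lebesgue_on B2)"
    using assms Bs by (auto simp: L2_disc_def set_integrable_def integrable_restrict_space)
  have [measurable]: "W \<mu> \<in> borel_measurable (lebesgue_on B2)"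
    by (intro borel_measurable_lebesgue_on measurable_W)
  have "integrable (lebesgue_on B2) (\<lambda>z. f z * g z * W \<mu> z)"
  proof (rule Bochner_Integration.integrable_bound[OF Bochner_Integration.integrable_add[OF i]])
    show "AE z in lebesgue_on B2. norm (f z * g z * W \<mu> z) \<le> norm ((f z)\<^sup>2 * W \<mu> z + (g z)\<^sup>2 * W \<mu> z)"
    proof (intro AE_I2)
      fix z
      have "2 * (\<bar>f z\<bar> * \<bar>g z\<bar>) \<le> (f z)\<^sup>2 + (g z)\<^sup>2"
        using sum_squares_bound[of "\<bar>f z\<bar>" "\<bar>g z\<bar>"] by simp
      moreover have "0 \<le> \<bar>f z\<bar> * \<bar>g z\<bar>" by simp
      ultimately have "\<bar>f z\<bar> * \<bar>g z\<bar> \<le> (f z)\<^sup>2 + (g z)\<^sup>2" by linarith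
      then have "\<bar>f z\<bar> * \<bar>g z\<bar> * W \<mu> z \<le> ((f z)\<^sup>2 + (g z)\<^sup>2) * W \<mu> z"
        using W_nonneg by (rule mult_right_mono)
      then show "norm (f z * g z * W \<mu> z) \<le> norm ((f z)\<^sup>2 * W \<mu> z + (g z)\<^sup>2 * W \<mu> z)"
        using W_nonneg[of \<mu> z] by (simp add: abs_mult distrib_right)
    qed
  qed measurable
  then show ?thesis using Bs by (simp add: set_integrable_def integrable_restrict_space)
qed

lemma disc_inner_commute: "disc_inner \<mu> f g = disc_inner \<mu> g f"
  by (simp add: disc_inner_def mult.commute)

lemma disc_inner_add:
  assumes "f \<in> L2_disc \<mu>" "g \<in> L2_disc \<mu>" "h \<in> L2_disc \<mu>"
  shows "disc_inner \<mu> (\<lambda>z. f z + g z) h = disc_inner \<mu> f h + disc_inner \<mu> g h"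
  using set_integral_add(2)[OF L2_mult_integrable[OF assms(1,3)] L2_mult_integrable[OF assms(2,3)]]
  by (simp add: disc_inner_def distrib_right distrib_left)

lemma disc_inner_scale: "disc_inner \<mu> (\<lambda>z. c * f z) h = c * disc_inner \<mu> f h"
  by (simp add: disc_inner_def mult.assoc)

lemma disc_inner_diff:
  assumes "f \<in> L2_disc \<mu>" "g \<in> L2_disc \<mu>" "h \<in> L2_disc \<mu>"
  shows "disc_inner \<mu> (\<lambda>z. f z - g z) h = disc_inner \<mu> f h - disc_inner \<mu> g h"
  using set_integral_diff(2)[OF L2_mult_integrable[OF assms(1,3)] L2_mult_integrable[OF assms(2,3)]]
  by (simp add: disc_inner_def left_diff_distrib right_diff_distrib)

lemma disc_inner_0: "disc_inner \<mu> (\<lambda>_. 0) h = 0"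
  by (simp add: disc_inner_def)

lemma disc_inner_sum:
  assumes "h \<in> L2_disc \<mu>" "finite A" "\<And>i. i \<in> A \<Longrightarrow> f i \<in> L2_disc \<mu>"
  shows "disc_inner \<mu> (\<lambda>z. \<Sum>i\<in>A. c i * f i z) h = (\<Sum>i\<in>A. c i * disc_inner \<mu> (f i) h)"
proof -
  have "set_integrable lebesgue B2 (\<lambda>z. c i * (f i z * h z * W \<mu> z))" if "i \<in> A" for i
    using L2_mult_integrable[OF assms(3)[OF that] assms(1)] by simp
  then have "(LINT z:B2|lebesgue. (\<Sum>i\<in>A. c i * (f i z * h z * W \<mu> z))) = (\<Sum>i\<in>A. LINT z:B2|lebesgue. c i * (f i z * h z * W \<mu> z))"
    unfolding set_lebesgue_integral_def set_integrable_def scaleR_sum_right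
    by (intro Bochner_Integration.integral_sum) auto
  then show ?thesis
    by (simp add: disc_inner_def sum_distrib_left sum_distrib_right mult.assoc mult.left_commute)
qed

text \<open>The weight is positive in the open disc, so the part of that disc where \<open>P\<close>
  is nonzero is open and negligible, hence empty.\<close>

lemma disc_inner_self_eq_0:
  assumes P: "P \<in> poly2_le n" and z: "disc_inner \<mu> P P = 0"
  shows "P = (\<lambda>_. 0)"
proof (rule poly2_eq_0_on_ball[OF P])
  have a: "a_const \<mu> > 0" using \<mu> by (simp add: a_const_def)
  let ?f = "\<lambda>z. indicator B2 z *\<^sub>R (P z * P z * W \<mu> z)"
  have i: "integrable lebesgue ?f"
    using L2_mult_integrable[OF poly2_L2[OF P] poly2_L2[OF P]] by (simp add: set_integrable_def)
  have nn: "AE z in lebesgue. 0 \<le> ?f z" using W_nonneg[of \<mu>] by (intro AE_I2) (simp flip: power2_eq_square)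
  have "integral\<^sup>L lebesgue ?f = 0" using z a by (simp add: disc_inner_def set_lebesgue_integral_def)
  then have ae: "AE z in lebesgue. ?f z = 0" using integral_nonneg_eq_0_iff_AE[OF i nn] by simp
  define U where "U = {z \<in> ball (0, 0) 1. P z \<noteq> 0}"
  have "U = ball (0, 0) 1 \<inter> P -` (- {0})" by (auto simp: U_def)
  then have "open U"
    using open_vimage[of "- {0::real}" P] poly2_le_continuous[OF P] by (auto intro!: open_Int)
  have "AE z in lebesgue. z \<notin> U"
    using ae
  proof eventually_elim
    case (elim z)
    show ?case
    proof
      assume "z \<in> U"
      then have b: "z \<in> ball (0, 0) 1" and p: "P z \<noteq> 0" by (auto simp: U_def)
      then have "z \<in> B2" by auto
      moreover have "nsq z < 1" using b by (cases z) (simp add: nsq_def dist_Pair_Pair dist_real_def)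
      then have "W \<mu> z > 0" by (simp add: W_eq_nsq)
      ultimately show False using elim p by simp
    qed
  qed
  then have "negligible U"
    using AE_iff_null_sets[of U lebesgue] \<open>open U\<close> by (simp add: negligible_iff_null_sets)
  then have "U = {}" using \<open>open U\<close> open_not_negligible by blast
  then show "\<And>z. z \<in> ball (0, 0) 1 \<Longrightarrow> P z = 0" by (auto simp: U_def)
qed

text \<open>Removes the exact degree from the definition of \<open>V\<close>: a polynomial of
  smaller degree that is orthogonal to all of \<open>low k\<close> is orthogonal to itself, hence
  zero.\<close>

lemma V_iff: "P \<in> V \<mu> k \<longleftrightarrow> P \<in> poly2_le k \<and> (\<forall>Q\<in>low k. disc_inner \<mu> P Q = 0)"
proof -
  have "P = (\<lambda>_. 0) \<or> has_degree2 P k" if "P \<in> poly2_le k" "\<forall>Q\<in>low k. disc_inner \<mu> P Q = 0"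
  proof (cases "P \<in> low k")
    case True
    then show ?thesis using that disc_inner_self_eq_0 by blast
  next
    case False
    then show ?thesis using that by (auto simp: has_degree2_def low_iff)
  qed
  moreover have "disc_inner \<mu> P (\<lambda>_. 0) = 0" by (simp add: disc_inner_def)
  ultimately show ?thesis
    unfolding V_def using poly2_le_zero by (auto simp: has_degree2_def low_iff)
qed

lemma V_poly2: "P \<in> V \<mu> k \<Longrightarrow> P \<in> poly2_le k" and V_orth: "P \<in> V \<mu> k \<Longrightarrow> Q \<in> low k \<Longrightarrow> disc_inner \<mu> P Q = 0"
  by (auto simp: V_iff)

lemma V_L2: "P \<in> V \<mu> k \<Longrightarrow> P \<in> L2_disc \<mu>"
  using V_poly2 poly2_L2 by blast

lemma low_L2: "P \<in> low k \<Longrightarrow> P \<in> L2_disc \<mu>"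
  using low_subset poly2_L2 by blast

lemma V_zero: "(\<lambda>_. 0) \<in> V \<mu> k"
  by (simp add: V_iff poly2_le_zero disc_inner_0)

lemma V_scale: "P \<in> V \<mu> k \<Longrightarrow> (\<lambda>z. c * P z) \<in> V \<mu> k"
  by (simp add: V_iff poly2_le_scale disc_inner_scale)

lemma V_add: "P \<in> V \<mu> k \<Longrightarrow> Q \<in> V \<mu> k \<Longrightarrow> (\<lambda>z. P z + Q z) \<in> V \<mu> k"
  by (auto simp: V_iff poly2_le_add disc_inner_add[OF poly2_L2 poly2_L2 low_L2])

lemma V_diff: "P \<in> V \<mu> k \<Longrightarrow> Q \<in> V \<mu> k \<Longrightarrow> (\<lambda>z. P z - Q z) \<in> V \<mu> k"
  using V_add[of P k "\<lambda>z. (-1) * Q z"] V_scale[of Q k "-1"] by simp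

lemma V_sum: "finite A \<Longrightarrow> (\<And>i. i \<in> A \<Longrightarrow> f i \<in> V \<mu> k) \<Longrightarrow> (\<lambda>z. \<Sum>i\<in>A. f i z) \<in> V \<mu> k"
  by (rule closed_sum[where P = "\<lambda>f. f \<in> V \<mu> k"]) (auto intro: V_zero V_add)

end

lemma nsq_rot: "nsq (rot \<theta> z) = nsq z"
  by (simp add: nsq_def norm_sq_rot)

lemma nsq_nonneg: "nsq z \<ge> 0"
  by (simp add: nsq_def)

lemma harm_span_poly2: "harm_span n f \<Longrightarrow> f \<in> poly2_le n"
proof (induction rule: harm_span.induct)
  case (gen \<epsilon> j i)
  have "(\<lambda>z. nsq z ^ i * harm j \<epsilon> z) \<in> poly2_le (i * 2 + j)"
    by (intro poly2_le_mult poly2_le_power poly2_le_nsq poly2_le_harm)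
  then show ?case using gen poly2_le_mono[of "i * 2 + j" n] by auto
qed (auto intro: poly2_le_zero poly2_le_add poly2_le_scale)

lemma poly2_le_nsq_poly:
  assumes "degree p * 2 \<le> n"
  shows "(\<lambda>z. poly p (2 * nsq z - 1)) \<in> poly2_le n"
  using poly2_le_poly[OF poly2_le_add[OF poly2_le_scale[OF poly2_le_nsq, of 2] poly2_le_const[of "-1" 2]] assms]
  by simp

lemma basis_index_admissible:
  "(l, \<epsilon>) \<in> basis_index k \<Longrightarrow> 2 * l \<le> k \<and> (\<epsilon> = 0 \<or> \<epsilon> = 1 \<and> 0 < k - 2 * l)"
  by (auto simp: basis_index_def)

lemma finite_basis_index: "finite (basis_index k)"
proof (rule finite_subset)
  show "basis_index k \<subseteq> {..k} \<times> {..1}" by (auto simp: basis_index_def)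
qed simp

context disc_weight
begin

text \<open>No integration over the angle is needed: averaging over a finite group of rotations, large
  compared with the frequencies, replaces the product of the angular factors by its mean value.\<close>

lemma integral_harm_mult:
  assumes \<epsilon>: "\<epsilon> = 0 \<or> \<epsilon> = 1 \<and> 0 < j" "\<epsilon>' = 0 \<or> \<epsilon>' = 1 \<and> 0 < j'"
  shows "(LINT z:B2|lebesgue. poly p (2 * nsq z - 1) * (harm j \<epsilon> z * harm j' \<epsilon>' z) * W \<mu> z) =
    (if j = j' \<and> \<epsilon> = \<epsilon>' then (if j = 0 then 1 else 1/2) *
       (LINT z:B2|lebesgue. poly p (2 * nsq z - 1) * nsq z ^ j * W \<mu> z) else 0)"
proof -
  \<comment> \<open>With more rotations than the largest frequency of the product, \<open>N\<close>
    divides neither the sum nor the difference of \<open>j\<close> and \<open>j'\<close> unless it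
    is zero.\<close>
  define N where "N = j + j' + 1"
  have N: "N > 0" by (simp add: N_def)
  define Q where "Q z = poly p (2 * nsq z - 1) * (harm j \<epsilon> z * harm j' \<epsilon>' z)" for z
  define \<theta> where "\<theta> \<nu> = 2 * pi * real \<nu> / real N" for \<nu>
  have "Q \<in> poly2_le (degree p * 2 + (j + j'))"
    unfolding Q_def[abs_def] by (intro poly2_le_mult poly2_le_nsq_poly poly2_le_harm) simp
  note Q = this
  have Qr: "(\<lambda>z. Q (rot \<theta> z)) \<in> poly2_le (degree p * 2 + (j + j'))" for \<theta>
    using Q by (rule poly2_le_rot)
  have [measurable]: "Q \<in> borel_measurable borel" using Q by (rule measurable_poly2)
  let ?I = "LINT z:B2|lebesgue. Q z * W \<mu> z"
  have s: "\<not> int N dvd int j + int j'" if "j + j' \<noteq> 0"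
    using that by (auto simp: N_def dest: zdvd_imp_le)
  have d: "\<not> int N dvd int j - int j'" if "j \<noteq> j'"
  proof
    assume "int N dvd int j - int j'"
    moreover have "int j - int j' \<noteq> 0" using that by simp
    ultimately have "\<bar>int N\<bar> \<le> \<bar>int j - int j'\<bar>" by (rule dvd_imp_le_int[rotated])
    then show False by (simp add: N_def)
  qed
  have pt: "(\<Sum>\<nu><N. Q (rot (\<theta> \<nu>) z)) =
     (if j = j' \<and> \<epsilon> = \<epsilon>' then real N * (if j = 0 then 1 else 1/2) else 0) * (poly p (2 * nsq z - 1) * sqrt (nsq z) ^ (j + j'))" for z
  proof -
    obtain x y where z: "z = (x, y)" by (cases z)
    have n: "sqrt (x\<^sup>2 + y\<^sup>2) = sqrt (nsq (x, y))" by (simp add: nsq_def)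
    have "(\<Sum>\<nu><N. Q (rot (\<theta> \<nu>) z)) = (\<Sum>\<nu><N. (poly p (2 * nsq z - 1) * sqrt (nsq z) ^ (j + j')) *
       (S_trig j \<epsilon> (Arg (Complex x y) + 2 * pi * real \<nu> / real N) * S_trig j' \<epsilon>' (Arg (Complex x y) + 2 * pi * real \<nu> / real N)))"
      unfolding Q_def nsq_rot \<theta>_def
      by (intro sum.cong refl) (simp add: z harm_rot n power_add mult_ac)
    then show ?thesis
      unfolding sum_distrib_left[symmetric] using sum_S_trig_mult[OF N s d \<epsilon>] by (simp add: mult.commute)
  qed
  have "real N * ?I = (\<Sum>\<nu><N. LINT z:B2|lebesgue. Q (rot (\<theta> \<nu>) z) * W \<mu> z)"
  proof -
    have "(LINT z:B2|lebesgue. Q (rot \<theta> z) * W \<mu> z) = ?I" for \<theta>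
      using disc_rot[of "\<lambda>z. Q z * W \<mu> z" \<theta>] by (simp add: W_rot)
    then show ?thesis by simp
  qed
  also have "\<dots> = (LINT z:B2|lebesgue. (\<Sum>\<nu><N. Q (rot (\<theta> \<nu>) z)) * W \<mu> z)"
    using set_integrable_poly2_W[OF Qr]
    unfolding set_lebesgue_integral_def set_integrable_def scaleR_sum_right sum_distrib_right
    by (intro Bochner_Integration.integral_sum[symmetric]) auto
  also have "\<dots> = real N * (if j = j' \<and> \<epsilon> = \<epsilon>' then (if j = 0 then 1 else 1/2) *
       (LINT z:B2|lebesgue. poly p (2 * nsq z - 1) * nsq z ^ j * W \<mu> z) else 0)"
  proof (cases "j = j' \<and> \<epsilon> = \<epsilon>'")
    case True
    have "sqrt (nsq z) ^ (j + j) = nsq z ^ j" for z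
      using nsq_nonneg[of z] by (simp add: power_add power_mult_distrib[symmetric])
    with True show ?thesis unfolding pt by (simp add: mult.assoc)
  next
    case False
    then show ?thesis unfolding pt by auto
  qed
  finally show ?thesis using N unfolding Q_def by simp
qed

section \<open>The basis functions belong to the space and span it\<close>

lemma jac_params:
  "(\<mu> - 1/2 :: real) > -1" "(real j :: real) > -1" "\<mu> - 1/2 + real j + 1 > 0"
  using \<mu> by auto

definition radial_poly :: "nat \<Rightarrow> nat \<Rightarrow> real poly" where
  "radial_poly k l = jacobi_orthonormal (\<mu> - 1/2) (real (k - 2 * l)) l"

lemma radial_poly_eq:
  "radial_poly k l = smult (1 / sqrt (beta_norm (real (k - 2 * l)) (\<mu> - 1/2) l)) (jac (\<mu> - 1/2) (real (k - 2 * l)) l)"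
  unfolding radial_poly_def by (rule jacobi_orthonormal_eq[OF jac_params])

lemma degree_radial_poly: "degree (radial_poly k l) = l"
  unfolding radial_poly_eq using beta_norm_pos[OF jac_params, of "k - 2 * l" l] degree_jac[OF jac_params, of "k - 2 * l" l] by simp

lemma poly_radial_poly_1: "poly (radial_poly k l) 1 = 1 / sqrt (beta_norm (real (k - 2 * l)) (\<mu> - 1/2) l)"
  unfolding radial_poly_eq by (simp add: poly_jac_1[OF jac_params])

lemma radial_poly_orth: "degree q < l \<Longrightarrow> jac_functional (\<mu> - 1/2) (real (k - 2 * l)) (radial_poly k l * q) = 0"
  unfolding radial_poly_eq
  using jac_functional_orth[OF jac_params, of q l "k - 2 * l"] by (simp add: jac_functional_smult[OF jac_params] mult.commute)

lemma basis_fun_radial: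
  "basis_fun \<mu> k l \<epsilon> = (\<lambda>z. h_const \<mu> l k * (poly (radial_poly k l) (2 * nsq z - 1) * harm (k - 2 * l) \<epsilon> z))"
  by (simp add: fun_eq_iff basis_fun_eq radial_poly_def mult.assoc)

lemma basis_fun_circle:
  "basis_fun \<mu> k l \<epsilon> (cos \<xi>, sin \<xi>) = h_const \<mu> l k * poly (radial_poly k l) 1 * S_trig (k - 2 * l) \<epsilon> \<xi>"
proof -
  have "nsq (cos \<xi>, sin \<xi>) = 1" by (simp add: nsq_def)
  then show ?thesis by (simp add: basis_fun_radial harm_circle)
qed

text \<open>It suffices to test against the generators of \<open>harm_span (k - 1)\<close>.
  Different angular factors are orthogonal; for equal ones the radial factor of the generator has
  degree below \<open>l\<close>, and Jacobi orthogonality applies.\<close>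

lemma basis_fun_V:
  assumes "(l, \<epsilon>) \<in> basis_index k"
  shows "basis_fun \<mu> k l \<epsilon> \<in> V \<mu> k"
proof -
  let ?j = "k - 2 * l"
  have l: "2 * l \<le> k" and \<epsilon>: "\<epsilon> = 0 \<or> \<epsilon> = 1 \<and> 0 < ?j"
    using basis_index_admissible[OF assms] by auto
  let ?B = "\<lambda>z. poly (radial_poly k l) (2 * nsq z - 1) * harm ?j \<epsilon> z"
  have B: "?B \<in> poly2_le k"
    using poly2_le_mult[OF poly2_le_nsq_poly[of "radial_poly k l" "2 * l"] poly2_le_harm[of ?j \<epsilon>]] l
    by (simp add: degree_radial_poly)
  have "disc_inner \<mu> Q ?B = 0" if "Q \<in> low k" for Q
  proof (cases "k = 0")
    case True
    then show ?thesis using that by (simp add: low_def disc_inner_0)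
  next
    case False
    with that have "harm_span (k - 1) Q" by (auto simp: low_def intro: poly2_le_harm_span)
    then show ?thesis
    proof (induction rule: harm_span.induct)
      case (add f g)
      then show ?case
        using disc_inner_add[OF poly2_L2[OF harm_span_poly2] poly2_L2[OF harm_span_poly2] poly2_L2[OF B]] by auto
    next
      case (gen \<epsilon>' j' i)
      \<comment> \<open>This is \<open>((1 + t) / 2) ^ i\<close>, the power \<open>nsq ^ i\<close>
        expressed in the Jacobi variable \<open>t = 2 * nsq - 1\<close>.\<close>
      let ?r = "[:1/2, 1/2:] ^ i :: real poly"
      have dr: "degree ?r = i" by (simp add: degree_power_eq)
      have "nsq z ^ i = poly ?r (2 * nsq z - 1)" for z
      proof -
        have "1/2 + (2 * nsq z - 1) / 2 = nsq z" by (simp add: field_simps)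
        then show ?thesis by (simp add: poly_power)
      qed
      then have "disc_inner \<mu> (\<lambda>z. nsq z ^ i * harm j' \<epsilon>' z) ?B = a_const \<mu> *
        (LINT z:B2|lebesgue. poly (radial_poly k l * ?r) (2 * nsq z - 1) * (harm ?j \<epsilon> z * harm j' \<epsilon>' z) * W \<mu> z)"
        by (simp add: disc_inner_def mult_ac)
      also have "\<dots> = 0"
      proof (cases "?j = j' \<and> \<epsilon> = \<epsilon>'")
        case True
        then have "i < l" using gen l False by auto
        then have o: "jac_functional (\<mu> - 1/2) (real ?j) (radial_poly k l * ?r) = 0"
          using dr by (intro radial_poly_orth) simp
        show ?thesis
          unfolding integral_harm_mult[OF \<epsilon> gen(1)] integral_radial o by simp
      next
        case False
        then show ?thesis unfolding integral_harm_mult[OF \<epsilon> gen(1)] by auto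
      qed
      finally show ?case .
    qed (simp_all add: disc_inner_0 disc_inner_scale)
  qed
  then have "?B \<in> V \<mu> k" using B by (simp add: V_iff disc_inner_commute)
  then show ?thesis unfolding basis_fun_radial by (rule V_scale)
qed

lemma h_const_pos: "h_const \<mu> l k > 0"
  using \<mu> unfolding h_const_def d_const_def
  by (auto intro!: divide_pos_pos mult_pos_pos Gamma_real_pos)

text \<open>Modulo lower degrees only the generators with \<open>2 * i + j = k\<close> count, and
  each of them is, up to a factor, the top-degree part of one basis function.\<close>

lemma basis_span_mod_low:
  assumes "Q \<in> poly2_le k"
  shows "\<exists>b. \<exists>R\<in>low k. Q = (\<lambda>z. (\<Sum>(l, \<epsilon>)\<in>basis_index k. b l \<epsilon> * basis_fun \<mu> k l \<epsilon> z) + R z)"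
  using poly2_le_harm_span[OF assms]
proof (induction rule: harm_span.induct)
  case zero
  show ?case by (intro exI[of _ "\<lambda>_ _. 0"] bexI[of _ "\<lambda>_. 0"]) (auto simp: low_iff)
next
  case (add f g)
  then obtain b R b' R' where "R \<in> low k" "R' \<in> low k"
    "f = (\<lambda>z. (\<Sum>(l, \<epsilon>)\<in>basis_index k. b l \<epsilon> * basis_fun \<mu> k l \<epsilon> z) + R z)"
    "g = (\<lambda>z. (\<Sum>(l, \<epsilon>)\<in>basis_index k. b' l \<epsilon> * basis_fun \<mu> k l \<epsilon> z) + R' z)" by blast
  then show ?case
    by (intro exI[of _ "\<lambda>l \<epsilon>. b l \<epsilon> + b' l \<epsilon>"] bexI[of _ "\<lambda>z. R z + R' z"])
      (auto simp: distrib_right sum.distrib case_prod_unfold low_add)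
next
  case (scale f a)
  then obtain b R where "R \<in> low k"
    "f = (\<lambda>z. (\<Sum>(l, \<epsilon>)\<in>basis_index k. b l \<epsilon> * basis_fun \<mu> k l \<epsilon> z) + R z)" by blast
  then show ?case
    by (intro exI[of _ "\<lambda>l \<epsilon>. a * b l \<epsilon>"] bexI[of _ "\<lambda>z. a * R z"])
      (auto simp: distrib_left sum_distrib_left case_prod_unfold mult.assoc low_scale)
next
  case (gen \<epsilon> j i)
  show ?case
  proof (cases "2 * i + j = k")
    case False
    then have "2 * i + j < k" using gen by simp
    moreover have "(\<lambda>z. nsq z ^ i * harm j \<epsilon> z) \<in> poly2_le (2 * i + j)"
      using harm_span_gen[of i j "2 * i + j" \<epsilon>] harm_span_poly2 by blast
    ultimately have "(\<lambda>z. nsq z ^ i * harm j \<epsilon> z) \<in> low k" by (auto simp: low_iff)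
    then show ?thesis by (intro exI[of _ "\<lambda>_ _. 0"] bexI[of _ "\<lambda>z. nsq z ^ i * harm j \<epsilon> z"]) auto
  next
    case True
    then have j: "j = k - 2 * i" by simp
    have idx: "(i, \<epsilon>) \<in> basis_index k" using gen True by (auto simp: basis_index_def)
    define P where "P = pcompose (radial_poly k i) [:-1, 2:]"
    have dP: "degree P = i" by (simp add: P_def degree_pcompose degree_radial_poly)
    have P0: "P \<noteq> 0"
    proof
      assume "P = 0"
      then have "radial_poly k i = 0" using pcompose_lin_inverse[of "radial_poly k i"] by (simp add: P_def)
      then show False using poly_radial_poly_1[of k i] beta_norm_pos[OF jac_params, of "k - 2 * i" i] by simp
    qed
    define c where "c = coeff P i"
    have c: "c \<noteq> 0" using P0 dP by (auto simp: c_def)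
    \<comment> \<open>The leading radial powers cancel, so the remaining radial polynomial times the
      harmonic has degree below \<open>k\<close>.\<close>
    define r where "r = monom 1 i - smult (1 / c) P"
    have "degree r \<le> i" unfolding r_def using dP
      by (intro degree_diff_le) (auto intro: degree_monom_le order.trans[OF degree_smult_le])
    moreover have "coeff r i = 0" using c by (simp add: r_def c_def)
    ultimately have r: "r = 0 \<or> degree r < i" by (rule eq_zero_or_degree_less)
    let ?R = "\<lambda>z. poly r (nsq z) * harm j \<epsilon> z"
    have R: "?R \<in> low k"
      using r
    proof
      assume d: "degree r < i"
      have "?R \<in> poly2_le (degree r * 2 + j)"
        by (intro poly2_le_mult poly2_le_poly[OF poly2_le_nsq] poly2_le_harm) simp
      moreover have "degree r * 2 + j < k" using d True by simp
      ultimately show ?thesis by (auto simp: low_iff)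
    qed (simp add: low_iff)
    let ?b = "\<lambda>l \<epsilon>'. if (l, \<epsilon>') = (i, \<epsilon>) then 1 / (c * h_const \<mu> i k) else 0"
    have "nsq z ^ i * harm j \<epsilon> z = (\<Sum>(l, \<epsilon>')\<in>basis_index k. ?b l \<epsilon>' * basis_fun \<mu> k l \<epsilon>' z) + ?R z" for z
    proof -
      have "(\<Sum>(l, \<epsilon>')\<in>basis_index k. ?b l \<epsilon>' * basis_fun \<mu> k l \<epsilon>' z) = 
        (\<Sum>p\<in>basis_index k. if p = (i, \<epsilon>) then 1 / (c * h_const \<mu> i k) * basis_fun \<mu> k i \<epsilon> z else 0)"
        by (intro sum.cong refl) (auto split: if_splits)
      also have "\<dots> = 1 / (c * h_const \<mu> i k) * basis_fun \<mu> k i \<epsilon> z"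
        using idx finite_basis_index[of k] by (simp add: sum.delta)
      also have "\<dots> = poly (smult (1 / c) P) (nsq z) * harm j \<epsilon> z"
        using h_const_pos[of i k] by (simp add: basis_fun_radial P_def poly_pcompose j algebra_simps)
      finally show ?thesis by (simp add: r_def poly_monom algebra_simps)
    qed
    then show ?thesis using R by (intro exI[of _ ?b] bexI[of _ ?R]) auto
  qed
qed

text \<open>The remainder \<open>R\<close> is a difference of elements of \<open>V \<mu> k\<close>
  and also lies in \<open>low k\<close>, so it is orthogonal to itself.\<close>

lemma V_spanned:
  assumes "Q \<in> V \<mu> k"
  shows "\<exists>b. Q = (\<lambda>z. \<Sum>(l, \<epsilon>)\<in>basis_index k. b l \<epsilon> * basis_fun \<mu> k l \<epsilon> z)"
proof -
  obtain b R where R: "R \<in> low k"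
    and Q: "Q = (\<lambda>z. (\<Sum>(l, \<epsilon>)\<in>basis_index k. b l \<epsilon> * basis_fun \<mu> k l \<epsilon> z) + R z)"
    using basis_span_mod_low[OF V_poly2[OF assms]] by blast
  let ?S = "\<lambda>z. \<Sum>(l, \<epsilon>)\<in>basis_index k. b l \<epsilon> * basis_fun \<mu> k l \<epsilon> z"
  have "?S \<in> V \<mu> k"
    unfolding case_prod_unfold by (intro V_sum finite_basis_index V_scale basis_fun_V) simp
  from V_diff[OF assms this] have "(\<lambda>z. Q z - ?S z) \<in> V \<mu> k" .
  moreover have "(\<lambda>z. Q z - ?S z) = R" by (simp add: Q)
  ultimately have "R \<in> V \<mu> k" by simp
  then have "R = (\<lambda>_. 0)" using V_orth[OF _ R] disc_inner_self_eq_0[OF V_poly2] by blast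
  then show ?thesis using Q by auto
qed

text \<open>With \<open>j = k - 2 * l\<close>, both \<open>fact (k - l)\<close> and
  \<open>pochhammer (\<mu> + 3/2) (k - l)\<close> split after \<open>j\<close> factors: the first
  parts come from \<open>h_const\<close>, the others from \<open>beta_norm\<close>.\<close>

lemma lambda_const_identity:
  assumes "2 * l \<le> k"
  shows "lambda_const \<mu> l k * (h_const \<mu> l k * poly (radial_poly k l) 1)\<^sup>2 * d_const l k = 1"
proof -
  define j where "j = k - 2 * l"
  have k: "k = 2 * l + j" "k - l = j + l" using assms by (auto simp: j_def)
  have d: "d_const l k > 0" by (simp add: d_const_def)
  have p: "pochhammer (\<mu> + 1/2) l > 0" "pochhammer (\<mu> + 3/2) j > 0" "pochhammer (\<mu> + 3/2 + real j) l > 0"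
    "pochhammer (real j + 1) l > 0"
    using \<mu> by (auto intro!: pochhammer_pos)
  have "beta_norm (real j) (\<mu> - 1/2) l = fact l * pochhammer (real j + 1) l * (real j + real l + \<mu> + 1/2) /
     (pochhammer (\<mu> + 1/2) l * pochhammer (\<mu> + 3/2 + real j) l * (real k + \<mu> + 1/2))"
    by (simp add: beta_norm_def k algebra_simps)
  moreover have "(poly (radial_poly k l) 1)\<^sup>2 = 1 / beta_norm (real j) (\<mu> - 1/2) l"
    using beta_norm_pos[OF jac_params, of j l] by (simp add: poly_radial_poly_1 power_divide j_def)
  moreover have "(h_const \<mu> l k)\<^sup>2 = 1 / d_const l k * (pochhammer (\<mu> + 3/2) j / fact j)"
  proof -
    have "Gamma (real j + \<mu> + 3/2) / Gamma (\<mu> + 3/2) = pochhammer (\<mu> + 3/2) j"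
      using \<mu> by (subst pochhammer_Gamma) (auto simp: nonpos_Ints_def add_ac)
    moreover have "Gamma (real j + 1) = fact j" by (simp add: Gamma_fact add.commute)
    moreover have "h_const \<mu> l k \<ge> 0" using h_const_pos less_imp_le by blast
    moreover have "1 / d_const l k * (Gamma (real j + \<mu> + 3/2) / (Gamma (\<mu> + 3/2) * Gamma (real j + 1))) \<ge> 0"
      using d \<mu> by (auto intro!: divide_nonneg_nonneg mult_nonneg_nonneg Gamma_real_nonneg)
    ultimately show ?thesis unfolding h_const_def j_def[symmetric]
      by (simp add: real_sqrt_pow2 flip: divide_divide_eq_left)
  qed
  moreover have "pochhammer (\<mu> + 3/2) (k - l) = pochhammer (\<mu> + 3/2) j * pochhammer (\<mu> + 3/2 + real j) l"
    unfolding k(2) by (rule pochhammer_product')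
  moreover have "(fact (k - l) :: real) = fact j * pochhammer (real j + 1) l"
    unfolding k(2) pochhammer_fact by (subst pochhammer_product') (simp add: add.commute)
  moreover have "real (k - l) + \<mu> + 1/2 = real j + real l + \<mu> + 1/2" unfolding k by simp
  moreover have "real k + \<mu> + 1/2 > 0" "real j + real l + \<mu> + 1/2 > 0" using \<mu> by auto
  moreover have "(fact l :: real) > 0" "(fact j :: real) > 0" by simp_all
  ultimately show ?thesis using d p
    unfolding lambda_const_def power_mult_distrib by (simp only: ) (simp add: divide_simps)
qed

section \<open>Recovery from the values at the equidistant nodes\<close>

lemma D_kernel_V: "(\<lambda>w. D_kernel \<mu> k \<xi> w) \<in> V \<mu> k"
  unfolding D_kernel_def case_prod_unfold by (intro V_sum finite_basis_index V_scale basis_fun_V) simp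

text \<open>By linearity \<open>Q\<close> may be a basis function. Summation over the nodes then
  keeps only the matching term of \<open>D_kernel\<close>, and \<open>lambda_const_identity\<close>
  reduces its coefficient to the number of nodes.\<close>

lemma discrete_reproducing:
  assumes k: "k \<le> 2 * m" and Q: "Q \<in> V \<mu> k"
  shows "(\<Sum>\<nu><2 * m + 1. Q (cos (2 * pi * real \<nu> / real (2 * m + 1)), sin (2 * pi * real \<nu> / real (2 * m + 1))) *
      D_kernel \<mu> k (2 * pi * real \<nu> / real (2 * m + 1)) w) = real (2 * m + 1) * Q w"
proof -
  define N where "N = 2 * m + 1"
  let ?\<phi> = "\<lambda>\<nu>. 2 * pi * real \<nu> / real N"
  have kN: "k < N" using k by (simp add: N_def)
  have basis: "(\<Sum>\<nu><N. basis_fun \<mu> k l \<epsilon> (cos (?\<phi> \<nu>), sin (?\<phi> \<nu>)) * D_kernel \<mu> k (?\<phi> \<nu>) w) = real N * basis_fun \<mu> k l \<epsilon> w"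
    if idx: "(l, \<epsilon>) \<in> basis_index k" for l \<epsilon>
  proof -
    let ?c = "\<lambda>l. h_const \<mu> l k * poly (radial_poly k l) 1"
    have orth: "(\<Sum>\<nu><N. S_trig (k - 2 * l) \<epsilon> (?\<phi> \<nu>) * S_trig (k - 2 * l') \<epsilon>' (?\<phi> \<nu>)) = 
      (if (l', \<epsilon>') = (l, \<epsilon>) then real N * d_const l k else 0)" if "(l', \<epsilon>') \<in> basis_index k" for l' \<epsilon>'
    proof -
      have a: "2 * l \<le> k" "\<epsilon> = 0 \<or> \<epsilon> = 1 \<and> 0 < k - 2 * l" "2 * l' \<le> k" "\<epsilon>' = 0 \<or> \<epsilon>' = 1 \<and> 0 < k - 2 * l'"
        using basis_index_admissible idx that by auto
      have s: "\<not> int N dvd int (k - 2 * l) + int (k - 2 * l')" if "k - 2 * l + (k - 2 * l') \<noteq> 0"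
      proof
        assume "int N dvd int (k - 2 * l) + int (k - 2 * l')"
        \<comment> \<open>The half \<open>k - l - l'\<close> of the sum is positive and below
          \<open>N\<close>, and an odd \<open>N\<close> dividing the sum would have to divide this
          half.\<close>
        moreover have "int (k - 2 * l) + int (k - 2 * l') = 2 * int (k - l - l')" using a by (simp add: of_nat_diff)
        moreover have "coprime (int N) 2" by (simp add: N_def)
        ultimately have "int N dvd int (k - l - l')" by (simp add: coprime_dvd_mult_right_iff)
        then have "N dvd k - l - l'" by (simp only: of_nat_dvd_iff)
        moreover have "k - l - l' > 0" using that a by linarith
        ultimately have "N \<le> k - l - l'" by (rule dvd_imp_le)
        with kN show False by linarith
      qed
      have d: "\<not> int N dvd int (k - 2 * l) - int (k - 2 * l')" if "k - 2 * l \<noteq> k - 2 * l'"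
      proof
        assume "int N dvd int (k - 2 * l) - int (k - 2 * l')"
        moreover have "int (k - 2 * l) - int (k - 2 * l') \<noteq> 0" using that by simp
        ultimately have "\<bar>int N\<bar> \<le> \<bar>int (k - 2 * l) - int (k - 2 * l')\<bar>" by (rule dvd_imp_le_int[rotated])
        with kN show False by linarith
      qed
      have "k - 2 * l = k - 2 * l' \<longleftrightarrow> l' = l" using a by auto
      then show ?thesis
        using sum_S_trig_mult[of N "k - 2 * l" "k - 2 * l'" \<epsilon> \<epsilon>' 0, OF _ s d a(2) a(4)] a kN
        by (auto simp: d_const_def)
    qed
    have "(\<Sum>\<nu><N. basis_fun \<mu> k l \<epsilon> (cos (?\<phi> \<nu>), sin (?\<phi> \<nu>)) * D_kernel \<mu> k (?\<phi> \<nu>) w) =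
      (\<Sum>\<nu><N. \<Sum>(l', \<epsilon>')\<in>basis_index k. ?c l * lambda_const \<mu> l' k * ?c l' * basis_fun \<mu> k l' \<epsilon>' w *
         (S_trig (k - 2 * l) \<epsilon> (?\<phi> \<nu>) * S_trig (k - 2 * l') \<epsilon>' (?\<phi> \<nu>)))"
      unfolding D_kernel_def basis_fun_circle sum_distrib_left case_prod_unfold
      by (intro sum.cong refl) (simp add: mult_ac)
    also have "\<dots> = (\<Sum>(l', \<epsilon>')\<in>basis_index k. ?c l * lambda_const \<mu> l' k * ?c l' * basis_fun \<mu> k l' \<epsilon>' w *
         (\<Sum>\<nu><N. S_trig (k - 2 * l) \<epsilon> (?\<phi> \<nu>) * S_trig (k - 2 * l') \<epsilon>' (?\<phi> \<nu>)))"
      by (subst sum.swap) (simp add: case_prod_unfold sum_distrib_left)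
    also have "\<dots> = (\<Sum>p\<in>basis_index k. if p = (l, \<epsilon>) then ?c l * lambda_const \<mu> l k * ?c l * basis_fun \<mu> k l \<epsilon> w *
         (real N * d_const l k) else 0)"
      proof (intro sum.cong refl)
      fix p assume p: "p \<in> basis_index k"
      obtain l' \<epsilon>' where p': "p = (l', \<epsilon>')" by (cases p)
      show "(case p of (l', \<epsilon>') \<Rightarrow> ?c l * lambda_const \<mu> l' k * ?c l' * basis_fun \<mu> k l' \<epsilon>' w *
         (\<Sum>\<nu><N. S_trig (k - 2 * l) \<epsilon> (?\<phi> \<nu>) * S_trig (k - 2 * l') \<epsilon>' (?\<phi> \<nu>))) =
         (if p = (l, \<epsilon>) then ?c l * lambda_const \<mu> l k * ?c l * basis_fun \<mu> k l \<epsilon> w * (real N * d_const l k) else 0)"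
        unfolding p' prod.case orth[OF p[unfolded p']] by (cases "(l', \<epsilon>') = (l, \<epsilon>)") auto
    qed
    also have "\<dots> = real N * basis_fun \<mu> k l \<epsilon> w * (lambda_const \<mu> l k * (?c l)\<^sup>2 * d_const l k)"
      using idx finite_basis_index[of k] by (simp add: sum.delta power2_eq_square mult_ac)
    also have "\<dots> = real N * basis_fun \<mu> k l \<epsilon> w"
      using basis_index_admissible[OF idx] by (simp only: lambda_const_identity mult_1_right)
    finally show ?thesis .
  qed
  obtain b where b: "Q = (\<lambda>z. \<Sum>(l, \<epsilon>)\<in>basis_index k. b l \<epsilon> * basis_fun \<mu> k l \<epsilon> z)"
    using V_spanned[OF Q] by blast
  have "(\<Sum>\<nu><N. Q (cos (?\<phi> \<nu>), sin (?\<phi> \<nu>)) * D_kernel \<mu> k (?\<phi> \<nu>) w) =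
    (\<Sum>(l, \<epsilon>)\<in>basis_index k. b l \<epsilon> * (\<Sum>\<nu><N. basis_fun \<mu> k l \<epsilon> (cos (?\<phi> \<nu>), sin (?\<phi> \<nu>)) * D_kernel \<mu> k (?\<phi> \<nu>) w))"
    unfolding b sum_distrib_right case_prod_unfold sum_distrib_left
    by (subst sum.swap) (simp only: mult.assoc)
  also have "\<dots> = (\<Sum>(l, \<epsilon>)\<in>basis_index k. b l \<epsilon> * (real N * basis_fun \<mu> k l \<epsilon> w))"
    by (intro sum.cong refl) (use basis in \<open>auto\<close>)
  also have "\<dots> = real N * Q w"
    unfolding b sum_distrib_left case_prod_unfold by (simp only: mult_ac)
  finally show ?thesis unfolding N_def .
qed

end

section \<open>Ridge polynomials and the projection\<close>

definition ridge :: "real poly \<Rightarrow> real \<Rightarrow> real \<times> real \<Rightarrow> real" where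
  "ridge g \<xi> z = poly g (fst z * cos \<xi> + snd z * sin \<xi>)"

lemma poly2_le_ridge: "degree g \<le> n \<Longrightarrow> ridge g \<xi> \<in> poly2_le n"
  unfolding ridge_def[abs_def]
  using poly2_le_poly[OF poly2_le_linear[of "cos \<xi>" "sin \<xi>"], of g n] by (simp add: mult.commute)

lemma ridge_rot: "ridge g \<xi> (rot \<xi> z) = poly g (fst z)"
proof -
  have "(fst z * cos \<xi> - snd z * sin \<xi>) * cos \<xi> + (fst z * sin \<xi> + snd z * cos \<xi>) * sin \<xi> = fst z * ((sin \<xi>)\<^sup>2 + (cos \<xi>)\<^sup>2)"
    by (simp only: power2_eq_square) algebra
  then show ?thesis by (simp add: ridge_def rot_def case_prod_unfold)
qed

section \<open>Slices of polynomials along parallel chords\<close>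

definition moment :: "real \<Rightarrow> nat \<Rightarrow> real" where
  "moment \<mu> j = (\<integral>u. indicator {-1..1} u * (u ^ j * (1 - u\<^sup>2) powr (\<mu> - 1/2)) \<partial>lborel)"

text \<open>Reflection of the rescaled chord. Apart from this vanishing no moment is evaluated: at
  \<open>t = 1\<close> only \<open>moment \<mu> 0\<close> survives, and
  \<open>moment_normalization\<close> removes it.\<close>

lemma moment_odd:
  assumes "odd j" shows "moment \<mu> j = 0"
proof -
  have "moment \<mu> j = (\<integral>u. indicator {-1..1} (- u) * ((- u) ^ j * (1 - (- u)\<^sup>2) powr (\<mu> - 1/2)) \<partial>lborel)"
    unfolding moment_def by (subst lborel_integral_real_affine[where t = 0 and c = "-1"]) auto
  also have "\<dots> = (\<integral>u. - (indicator {-1..1} u * (u ^ j * (1 - u\<^sup>2) powr (\<mu> - 1/2))) \<partial>lborel)"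
    using assms by (intro Bochner_Integration.integral_cong refl) (auto simp: indicator_def)
  also have "\<dots> = - moment \<mu> j" unfolding moment_def by (rule Bochner_Integration.integral_minus)
  finally show ?thesis by simp
qed

text \<open>Rescaling by the half chord length \<open>c = sqrt (1 - t\<^sup>2)\<close>: the
  differential gives \<open>c\<close>, the monomial \<open>c ^ j\<close>, and the weight the power
  \<open>2 * \<mu> - 1\<close> of \<open>c\<close>, which together make
  \<open>c ^ j * (1 - t\<^sup>2) powr \<mu>\<close>.\<close>

lemma radon_monom:
  assumes t: "t\<^sup>2 < 1"
  shows "radon \<mu> 0 (\<lambda>z. fst z ^ i * snd z ^ j) t = t ^ i * sqrt (1 - t\<^sup>2) ^ j * (1 - t\<^sup>2) powr \<mu> * moment \<mu> j"
proof -
  define c where "c = sqrt (1 - t\<^sup>2)"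
  have c: "c > 0" "c\<^sup>2 = 1 - t\<^sup>2" using t by (auto simp: c_def)
  have "radon \<mu> 0 (\<lambda>z. fst z ^ i * snd z ^ j) t =
    (\<integral>s. indicator {-c..c} s * (t ^ i * s ^ j * (1 - s\<^sup>2 - t\<^sup>2) powr (\<mu> - 1/2)) \<partial>lborel)"
    unfolding radon_def c_def by (subst set_lebesgue_eq_lborel) (auto simp: set_lebesgue_integral_def)
  also have "\<dots> = c * (\<integral>u. indicator {-c..c} (c * u) * (t ^ i * (c * u) ^ j * (1 - (c * u)\<^sup>2 - t\<^sup>2) powr (\<mu> - 1/2)) \<partial>lborel)"
    using c by (subst lborel_integral_real_affine[where t = 0 and c = c]) auto
  also have "\<dots> = c * (\<integral>u. (t ^ i * c ^ j * (c\<^sup>2) powr (\<mu> - 1/2)) * (indicator {-1..1} u * (u ^ j * (1 - u\<^sup>2) powr (\<mu> - 1/2))) \<partial>lborel)"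
  proof -
    have "indicator {-c..c} (c * u) * (t ^ i * (c * u) ^ j * (1 - (c * u)\<^sup>2 - t\<^sup>2) powr (\<mu> - 1/2)) =
      (t ^ i * c ^ j * (c\<^sup>2) powr (\<mu> - 1/2)) * (indicator {-1..1} u * (u ^ j * (1 - u\<^sup>2) powr (\<mu> - 1/2)))" for u :: real
    proof (cases "u \<in> {-1..1}")
      case True
      then have "c * u \<in> {-c..c}"
        using mult_le_cancel_left_pos[OF c(1), of "-1" u] mult_le_cancel_left_pos[OF c(1), of u 1] by simp
      moreover have "1 - (c * u)\<^sup>2 - t\<^sup>2 = c\<^sup>2 * (1 - u\<^sup>2)" using c(2) by (simp add: algebra_simps power_mult_distrib)
      moreover have "u\<^sup>2 \<le> 1" using True abs_square_le_1[of u] by (auto simp: abs_le_iff)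
      ultimately show ?thesis using True by (simp add: powr_mult power_mult_distrib mult_ac)
    next
      case False
      then have "c * u \<notin> {-c..c}"
        using mult_le_cancel_left_pos[OF c(1), of "-1" u] mult_le_cancel_left_pos[OF c(1), of u 1] by simp
      then show ?thesis using False by simp
    qed
    then show ?thesis by (simp only:)
  qed
  also have "\<dots> = c * (t ^ i * c ^ j * (c\<^sup>2) powr (\<mu> - 1/2)) * moment \<mu> j"
    by (simp add: moment_def)
  also have "c * (t ^ i * c ^ j * (c\<^sup>2) powr (\<mu> - 1/2)) = t ^ i * c ^ j * (c\<^sup>2) powr \<mu>"
  proof -
    have "c = (c\<^sup>2) powr (1/2)" using c(1) by (simp add: powr_half_sqrt)
    then have "c * (c\<^sup>2) powr (\<mu> - 1/2) = (c\<^sup>2) powr (1/2 + (\<mu> - 1/2))"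
      by (metis powr_add)
    then show ?thesis by (simp add: mult_ac)
  qed
  finally show ?thesis by (simp add: c(2)) (simp add: c_def)
qed

context disc_weight
begin

lemma a_const_pos: "a_const \<mu> > 0"
  using \<mu> by (simp add: a_const_def)

lemma gegenbauer_params: "\<mu> > -1" "\<mu> + \<mu> + 1 > 0"
  using \<mu> by auto

lemma jac_functional_add_right:
  "jac_functional \<mu> \<mu> (g * (p + q)) = jac_functional \<mu> \<mu> (g * p) + jac_functional \<mu> \<mu> (g * q)"
  using \<mu> by (simp add: jac_functional_eq pcompose_mult pcompose_add distrib_left beta_functional_add)

text \<open>Here \<open>q\<close> is the slice of \<open>P\<close> divided by
  \<open>(1 - t\<^sup>2) powr \<mu>\<close>. It is a polynomial because odd powers of the half chord
  come with a vanishing moment and even ones are powers of \<open>1 - t\<^sup>2\<close>. One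
  \<open>q\<close> serves all \<open>g\<close>, so orthogonality of \<open>P\<close> to ridges can
  be read off from \<open>q\<close>.\<close>

lemma slice_integral_axis:
  assumes "P \<in> poly2_le n"
  shows "\<exists>q. degree q \<le> n \<and> poly q 1 = moment \<mu> 0 * P (1, 0) \<and>
    (\<forall>g. (LINT z:B2|lebesgue. P z * poly g (fst z) * W \<mu> z) = jac_functional \<mu> \<mu> (g * q))"
proof -
  have i: "set_integrable lebesgue B2 (\<lambda>z. f z * poly g (fst z) * W \<mu> z)" if "f \<in> poly2_le n'" for f g n'
  proof -
    have "(\<lambda>z. poly g (fst z)) \<in> poly2_le (degree g)"
      using poly2_le_poly[OF poly2_le_monom[of 1 0 1], of g "degree g"] by simp
    from set_integrable_poly2_W[OF poly2_le_mult[OF that this]] show ?thesis .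
  qed
  \<comment> \<open>Membership is carried through the induction because additivity of the integrals
    requires integrability of both summands.\<close>
  have "P \<in> poly2_le n \<and> (\<exists>q. degree q \<le> n \<and> poly q 1 = moment \<mu> 0 * P (1, 0) \<and>
    (\<forall>g. (LINT z:B2|lebesgue. P z * poly g (fst z) * W \<mu> z) = jac_functional \<mu> \<mu> (g * q)))"
    using assms
  proof (induction rule: poly2_le_induct)
    case zero
    show ?case by (auto intro!: exI[of _ 0] poly2_le_zero simp: jac_functional_def)
  next
    case (add f h)
    then obtain q q' where q: "degree q \<le> n" "poly q 1 = moment \<mu> 0 * f (1, 0)"
      "\<And>g. (LINT z:B2|lebesgue. f z * poly g (fst z) * W \<mu> z) = jac_functional \<mu> \<mu> (g * q)"
      "degree q' \<le> n" "poly q' 1 = moment \<mu> 0 * h (1, 0)"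
      "\<And>g. (LINT z:B2|lebesgue. h z * poly g (fst z) * W \<mu> z) = jac_functional \<mu> \<mu> (g * q')"
      and fh: "f \<in> poly2_le n" "h \<in> poly2_le n" by blast
    have "(LINT z:B2|lebesgue. (f z + h z) * poly g (fst z) * W \<mu> z) = jac_functional \<mu> \<mu> (g * (q + q'))" for g
      using set_integral_add(2)[OF i[OF fh(1), of g] i[OF fh(2), of g]] q(3,6)[of g]
      by (simp add: distrib_right jac_functional_add_right)
    then show ?case using q fh
      by (auto intro!: exI[of _ "q + q'"] degree_add_le poly2_le_add simp: distrib_left)
  next
    case (scale a f)
    then obtain q where q: "degree q \<le> n" "poly q 1 = moment \<mu> 0 * f (1, 0)"
      "\<And>g. (LINT z:B2|lebesgue. f z * poly g (fst z) * W \<mu> z) = jac_functional \<mu> \<mu> (g * q)"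
      and f: "f \<in> poly2_le n" by blast
    have "(LINT z:B2|lebesgue. a * f z * poly g (fst z) * W \<mu> z) = jac_functional \<mu> \<mu> (g * smult a q)" for g
      using q(3)[of g] by (simp add: mult.assoc jac_functional_smult[OF gegenbauer_params(1) gegenbauer_params])
    then show ?case using q f
      by (auto intro!: exI[of _ "smult a q"] order.trans[OF degree_smult_le] poly2_le_scale)
  next
    case (monom a b)
    let ?P = "\<lambda>z :: real \<times> real. fst z ^ a * snd z ^ b"
    have P: "?P \<in> poly2_le n" using monom by (rule poly2_le_monom)
    \<comment> \<open>For odd \<open>b\<close> the moment makes \<open>q\<close> zero; for even
      \<open>b\<close> the exponent is exactly half of \<open>b\<close>, as
      \<open>sqrt (1 - t\<^sup>2) ^ b\<close> demands.\<close>
    define q where "q = smult (moment \<mu> b) (monom 1 a * [:1, 0, -1:] ^ (b div 2))"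
    have "degree q \<le> a + 2 * (b div 2)"
      unfolding q_def using degree_mult_le[of "monom (1::real) a" "[:1, 0, -1:] ^ (b div 2)"]
      by (intro order.trans[OF degree_smult_le]) (simp add: degree_monom_eq degree_power_eq)
    then have d: "degree q \<le> n" using monom by linarith
    have v: "poly q 1 = moment \<mu> 0 * ?P (1, 0)"
    proof (cases "b = 0")
      case False
      then have "moment \<mu> b * 0 ^ (b div 2) = 0"
        using moment_odd[of b \<mu>] by (cases "even b") (auto simp: zero_power elim!: evenE)
      then show ?thesis using False by (simp add: q_def poly_monom poly_power zero_power)
    qed (simp add: q_def poly_monom)
    have "(LINT z:B2|lebesgue. ?P z * poly g (fst z) * W \<mu> z) = jac_functional \<mu> \<mu> (g * q)" for g
    proof -
      have "(LINT z:B2|lebesgue. ?P z * poly g (fst z) * W \<mu> z) = (LINT t:{-1..1}|lebesgue. radon \<mu> 0 ?P t * poly g t)"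
        using radon_integral[of ?P "poly g" 0 \<mu>] i[OF P, of g] by simp
      also have "\<dots> = jac_functional \<mu> \<mu> (g * q)"
      proof -
        have "AE t in lborel. t \<noteq> -1 \<and> t \<noteq> (1::real)"
          by (intro AE_conjI AE_lborel_singleton)
        then have ae: "AE t in lborel. indicator {-1..1} t * (radon \<mu> 0 ?P t * poly g t) =
          indicator {-1..1} t * (poly (g * q) t * jacobi_weight \<mu> \<mu> t)"
        proof eventually_elim
          case (elim t)
          show ?case
          proof (cases "t \<in> {-1..1}")
            case True
            then have t: "-1 < t" "t < 1" using elim by auto
            then have t2: "t\<^sup>2 < 1" by (simp add: abs_square_less_1 abs_less_iff)
            have w: "jacobi_weight \<mu> \<mu> t = (1 - t\<^sup>2) powr \<mu>"
            proof -
              have "1 - t\<^sup>2 = (1 - t) * (1 + t)" by (simp add: power2_eq_square algebra_simps)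
              then show ?thesis using t by (simp add: jacobi_weight_def powr_mult)
            qed
            have "sqrt (1 - t\<^sup>2) ^ b * moment \<mu> b = (1 - t\<^sup>2) ^ (b div 2) * moment \<mu> b"
            proof (cases "even b")
              case True
              then obtain c where "b = 2 * c" by blast
              then show ?thesis using t2 by (simp add: power_mult)
            qed (simp add: moment_odd)
            moreover have "poly q t = t ^ a * ((1 - t\<^sup>2) ^ (b div 2) * moment \<mu> b)"
              by (simp add: q_def poly_monom poly_power power2_eq_square)
            ultimately have "radon \<mu> 0 ?P t = poly q t * jacobi_weight \<mu> \<mu> t"
              by (simp add: radon_monom[OF t2] w)
            then show ?thesis by simp
          qed simp
        qed
        have m: "(\<lambda>t. indicator {-1..1} t * (poly (g * q) t * jacobi_weight \<mu> \<mu> t)) \<in> borel_measurable borel"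
          by measurable
        show ?thesis
          unfolding jac_functional_def set_lebesgue_integral_def real_scaleR_def
          by (intro integral_cong_AE borel_measurable_lebesgue_AE[OF m ae] measurable_completion AE_completion[OF ae])
             (use m in simp)
      qed
      finally show ?thesis .
    qed
    then show ?case using P d v by blast
  qed
  then show ?thesis by blast
qed

text \<open>Rotation by \<xi> leaves disc and weight unchanged, turns the ridge into a function of
  the first coordinate, and carries \<open>(1, 0)\<close> to
  \<open>(cos \<xi>, sin \<xi>)\<close>.\<close>

lemma ridge_inner:
  assumes Q: "Q \<in> poly2_le n"
  shows "\<exists>q. degree q \<le> n \<and> poly q 1 = moment \<mu> 0 * Q (cos \<xi>, sin \<xi>) \<and>
    (\<forall>g. disc_inner \<mu> (ridge g \<xi>) Q = a_const \<mu> * jac_functional \<mu> \<mu> (g * q))"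
proof -
  obtain q where q: "degree q \<le> n" "poly q 1 = moment \<mu> 0 * Q (rot \<xi> (1, 0))"
    "\<And>g. (LINT z:B2|lebesgue. Q (rot \<xi> z) * poly g (fst z) * W \<mu> z) = jac_functional \<mu> \<mu> (g * q)"
    using slice_integral_axis[OF poly2_le_rot[OF Q, of \<xi>]] by blast
  have [measurable]: "Q \<in> borel_measurable borel" "ridge g \<xi> \<in> borel_measurable borel" for g
    using Q poly2_le_ridge by (auto intro: measurable_poly2)
  have "disc_inner \<mu> (ridge g \<xi>) Q = a_const \<mu> * jac_functional \<mu> \<mu> (g * q)" for g
    using disc_rot[of "\<lambda>z. ridge g \<xi> z * Q z * W \<mu> z" \<xi>] q(3)[of g]
    by (simp add: disc_inner_def ridge_rot W_rot mult.commute[of "poly g _"])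
  then show ?thesis using q by (auto simp: rot_def)
qed

lemma integral_W: "a_const \<mu> * (LINT z:B2|lebesgue. W \<mu> z) = 1"
proof -
  have "(LINT z:B2|lebesgue. W \<mu> z) = pi * beta_functional 0 (\<mu> - 1/2) 1"
    using integral_radial[of 1 0] by (simp add: jac_functional_eq pcompose_1 add.commute)
  also have "beta_functional 0 (\<mu> - 1/2) 1 = Beta 1 (\<mu> + 1/2)"
    using beta_functional_moment[of 0 "\<mu> - 1/2" 0 0] \<mu> by (simp add: monom_0 one_pCons add.commute)
  also have "\<dots> = 1 / (\<mu> + 1/2)"
  proof -
    have "Gamma (\<mu> + 1/2 + 1) = (\<mu> + 1/2) * Gamma (\<mu> + 1/2)"
      using \<mu> by (intro Gamma_plus1) (auto simp: nonpos_Ints_def)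
    moreover have "Gamma (\<mu> + 1/2) > 0" using \<mu> by (intro Gamma_real_pos) simp
    ultimately show ?thesis by (simp add: Beta_def add.commute)
  qed
  finally show ?thesis using \<mu> by (simp add: a_const_def)
qed

text \<open>The slicing formula applied to constants: it yields the product of the two
  one-dimensional integrals from the total mass of the disc weight, without evaluating
  either.\<close>

lemma moment_normalization: "a_const \<mu> * moment \<mu> 0 * jac_functional \<mu> \<mu> 1 = 1"
proof -
  obtain q where q: "degree q \<le> 0" "poly q 1 = moment \<mu> 0"
    "\<And>g. disc_inner \<mu> (ridge g 0) (\<lambda>_. 1) = a_const \<mu> * jac_functional \<mu> \<mu> (g * q)"
    using ridge_inner[OF poly2_le_const[of 1 0], of 0] by auto
  from q(1,2) have "q = smult (moment \<mu> 0) 1" by (auto elim!: degree_eq_zeroE simp: le_zero_eq)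
  then have "disc_inner \<mu> (ridge 1 0) (\<lambda>_. 1) = a_const \<mu> * moment \<mu> 0 * jac_functional \<mu> \<mu> 1"
    using q(3)[of 1] jac_functional_smult[OF gegenbauer_params(1) gegenbauer_params, of "moment \<mu> 0" 1] by simp
  moreover have "disc_inner \<mu> (ridge 1 0) (\<lambda>_. 1) = 1"
    using integral_W by (simp add: disc_inner_def ridge_def)
  ultimately show ?thesis by simp
qed

section \<open>Gegenbauer ridges as reproducing elements\<close>

lemma gegenbauer_jac:
  "gegenbauer (\<mu> + 1/2) k = smult (pochhammer (2 * \<mu> + 1) k / fact k) (jac \<mu> \<mu> k)"
  using gegenbauer_eq[of "\<mu> + 1/2" k] \<mu> by (simp add: distrib_left)

lemma degree_gegenbauer: "degree (gegenbauer (\<mu> + 1/2) k) \<le> k"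
  unfolding gegenbauer_jac using degree_jac[OF gegenbauer_params(1) gegenbauer_params]
  by (intro order.trans[OF degree_smult_le]) simp

text \<open>Slicing replaces a polynomial of degree below \<open>k\<close> by one variable of degree
  below \<open>k\<close> and the weight \<open>(1 - t\<^sup>2) powr \<mu>\<close>, for which the
  Gegenbauer polynomial is orthogonal to it.\<close>

lemma gegenbauer_ridge_V: "ridge (gegenbauer (\<mu> + 1/2) k) \<xi> \<in> V \<mu> k"
proof -
  have "disc_inner \<mu> (ridge (gegenbauer (\<mu> + 1/2) k) \<xi>) Q = 0" if low: "Q \<in> low k" for Q
    using low unfolding low_iff
  proof
    assume "Q = (\<lambda>_. 0)"
    then show ?thesis by (simp add: disc_inner_def)
  next
    assume "\<exists>n<k. Q \<in> poly2_le n"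
    then obtain n where n: "n < k" "Q \<in> poly2_le n" by blast
    obtain q where q: "degree q \<le> n"
      "\<And>g. disc_inner \<mu> (ridge g \<xi>) Q = a_const \<mu> * jac_functional \<mu> \<mu> (g * q)"
      using ridge_inner[OF n(2)] by blast
    have "jac_functional \<mu> \<mu> (q * jac \<mu> \<mu> k) = 0"
      using q(1) n(1) by (intro jac_functional_orth[OF gegenbauer_params(1) gegenbauer_params]) simp
    then show ?thesis unfolding q(2) gegenbauer_jac
      by (simp add: jac_functional_smult[OF gegenbauer_params(1) gegenbauer_params] mult.commute)
  qed
  then show ?thesis using degree_gegenbauer by (simp add: V_iff poly2_le_ridge)
qed

text \<open>The left side is the squared norm of the Gegenbauer polynomial, for the weight of mass
  1, divided by its value at 1. The rising factorials from \<open>2 * \<mu> + 1\<close> and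
  \<open>2 * \<mu> + 2\<close> nearly cancel; the reciprocal of what remains is the factor in
  \<open>Phi\<close>.\<close>

lemma gegenbauer_norm:
  "pochhammer (2 * \<mu> + 1) k / fact k * beta_norm \<mu> \<mu> k = (\<mu> + 1/2) / (real k + \<mu> + 1/2)"
proof -
  define s where "s = 2 * \<mu> + 1"
  have s: "s > 0" using \<mu> by (simp add: s_def)
  have p: "pochhammer (\<mu> + 1) k > 0" "pochhammer (s + 1) k > 0" using \<mu> s by (auto intro!: pochhammer_pos)
  have "pochhammer s k * (real k + s) = s * pochhammer (s + 1) k"
    using pochhammer_rec[of s k] pochhammer_rec'[of s k] by (simp add: mult.commute add.commute)
  then have e: "pochhammer s k = s * pochhammer (s + 1) k / (real k + s)" using s by (simp add: field_simps)
  have n: "beta_norm \<mu> \<mu> k = fact k * pochhammer (\<mu> + 1) k * (real k + s) /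
     (pochhammer (\<mu> + 1) k * pochhammer (s + 1) k * (2 * (real k + \<mu> + 1/2)))"
    by (simp add: beta_norm_def s_def algebra_simps)
  have r: "(\<mu> + 1/2) / (real k + \<mu> + 1/2) = s / (2 * (real k + \<mu> + 1/2))"
    using \<mu> by (simp add: s_def field_simps)
  show ?thesis
    unfolding s_def[symmetric] e n r using s p by (simp add: divide_simps)
qed

text \<open>The slices of \<open>Q\<close> along the direction \<open>\<xi>\<close> give a polynomial orthogonal to all lower
  degrees, hence a multiple of the Gegenbauer polynomial; its value at \<open>t = 1\<close>, where the chord
  shrinks to a point, fixes the multiple.\<close>

lemma gegenbauer_ridge_reproducing:
  assumes Q: "Q \<in> V \<mu> k"
  shows "(real k + \<mu> + 1/2) / (\<mu> + 1/2) * disc_inner \<mu> (ridge (gegenbauer (\<mu> + 1/2) k) \<xi>) Q = Q (cos \<xi>, sin \<xi>)"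
proof -
  obtain q where q: "degree q \<le> k" "poly q 1 = moment \<mu> 0 * Q (cos \<xi>, sin \<xi>)"
    "\<And>g. disc_inner \<mu> (ridge g \<xi>) Q = a_const \<mu> * jac_functional \<mu> \<mu> (g * q)"
    using ridge_inner[OF V_poly2[OF Q]] by blast
  have "jac_functional \<mu> \<mu> (q * p) = 0" if "degree p < k" for p
  proof -
    have "ridge p \<xi> \<in> low k" using that poly2_le_ridge by (auto simp: low_iff)
    then have "disc_inner \<mu> (ridge p \<xi>) Q = 0" using V_orth[OF Q] disc_inner_commute by metis
    then show ?thesis using q(3)[of p] a_const_pos by (simp add: mult.commute)
  qed
  from jac_unique[OF gegenbauer_params(1) gegenbauer_params q(1) this]
  have qj: "q = smult (moment \<mu> 0 * Q (cos \<xi>, sin \<xi>)) (jac \<mu> \<mu> k)" by (simp add: q(2))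
  have "disc_inner \<mu> (ridge (gegenbauer (\<mu> + 1/2) k) \<xi>) Q =
    (a_const \<mu> * moment \<mu> 0 * jac_functional \<mu> \<mu> 1) * Q (cos \<xi>, sin \<xi>) * (pochhammer (2 * \<mu> + 1) k / fact k * beta_norm \<mu> \<mu> k)"
    unfolding q(3) gegenbauer_jac
    by (simp add: qj jac_functional_smult[OF gegenbauer_params(1) gegenbauer_params]
      jac_functional_norm[OF gegenbauer_params(1) gegenbauer_params] mult_ac)
  also have "\<dots> = Q (cos \<xi>, sin \<xi>) * ((\<mu> + 1/2) / (real k + \<mu> + 1/2))"
    by (simp only: moment_normalization gegenbauer_norm mult_1_left)
  finally show ?thesis using \<mu> by simp
qed

text \<open>The hypothesis says that the operator with kernel \<open>\<Sum>i. A i z * B i w\<close> restricts to the identity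
  of \<open>V \<mu> k\<close>; so does its adjoint, and this gives the other half of the characterization of the
  projection.\<close>

lemma proj_eq_finite_kernel:
  assumes f: "f \<in> L2_disc \<mu>" and I: "finite I"
    and A: "\<And>i. i \<in> I \<Longrightarrow> A i \<in> V \<mu> k" and B: "\<And>i. i \<in> I \<Longrightarrow> B i \<in> V \<mu> k"
    and id: "\<And>Q w. Q \<in> V \<mu> k \<Longrightarrow> (\<Sum>i\<in>I. disc_inner \<mu> (A i) Q * B i w) = Q w"
  shows "proj \<mu> k f = (\<lambda>w. \<Sum>i\<in>I. disc_inner \<mu> (A i) f * B i w)"
proof -
  let ?G = "\<lambda>w. \<Sum>i\<in>I. disc_inner \<mu> (A i) f * B i w"
  have G: "?G \<in> V \<mu> k" using I B by (intro V_sum V_scale) auto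
  have dual: "(\<lambda>z. \<Sum>i\<in>I. disc_inner \<mu> (B i) Q * A i z) = Q" if Q: "Q \<in> V \<mu> k" for Q
  proof -
    let ?Q = "\<lambda>z. \<Sum>i\<in>I. disc_inner \<mu> (B i) Q * A i z"
    have Q': "?Q \<in> V \<mu> k" using I A by (intro V_sum V_scale) auto
    have "disc_inner \<mu> (\<lambda>z. ?Q z - Q z) R = 0" if R: "R \<in> V \<mu> k" for R
    proof -
      have "disc_inner \<mu> ?Q R = (\<Sum>i\<in>I. disc_inner \<mu> (B i) Q * disc_inner \<mu> (A i) R)"
        by (intro disc_inner_sum V_L2[OF R] I V_L2[OF A])
      also have "\<dots> = (\<Sum>i\<in>I. disc_inner \<mu> (A i) R * disc_inner \<mu> (B i) Q)"
        by (simp only: mult.commute)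
      also have "\<dots> = disc_inner \<mu> (\<lambda>w. \<Sum>i\<in>I. disc_inner \<mu> (A i) R * B i w) Q"
        by (intro disc_inner_sum[symmetric] V_L2[OF Q] I V_L2[OF B])
      also have "\<dots> = disc_inner \<mu> R Q" using id[OF R] by simp
      finally show ?thesis
        using disc_inner_diff[OF V_L2[OF Q'] V_L2[OF Q] V_L2[OF R]] by (simp add: disc_inner_commute)
    qed
    from this[OF V_diff[OF Q' Q]] have "(\<lambda>z. ?Q z - Q z) = (\<lambda>_. 0)"
      by (rule disc_inner_self_eq_0[OF V_poly2[OF V_diff[OF Q' Q]]])
    then show ?thesis by (simp add: fun_eq_iff)
  qed
  have orth: "disc_inner \<mu> (\<lambda>z. f z - ?G z) Q = 0" if Q: "Q \<in> V \<mu> k" for Q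
  proof -
    have "disc_inner \<mu> ?G Q = (\<Sum>i\<in>I. disc_inner \<mu> (A i) f * disc_inner \<mu> (B i) Q)"
      by (intro disc_inner_sum V_L2[OF Q] I V_L2[OF B])
    also have "\<dots> = (\<Sum>i\<in>I. disc_inner \<mu> (B i) Q * disc_inner \<mu> (A i) f)"
      by (simp only: mult.commute)
    also have "\<dots> = disc_inner \<mu> (\<lambda>z. \<Sum>i\<in>I. disc_inner \<mu> (B i) Q * A i z) f"
      by (intro disc_inner_sum[symmetric] f I V_L2[OF A])
    also have "\<dots> = disc_inner \<mu> f Q" using dual[OF Q] by (simp add: disc_inner_commute)
    finally show ?thesis using disc_inner_diff[OF f V_L2[OF G] V_L2[OF Q]] by simp
  qed
  show ?thesis unfolding proj_def
  proof (rule the_equality, goal_cases)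
    case 1
    show ?case using G orth by blast
  next
    case (2 P)
    then have P: "P \<in> V \<mu> k" and o: "\<And>Q. Q \<in> V \<mu> k \<Longrightarrow> disc_inner \<mu> (\<lambda>z. f z - P z) Q = 0" by auto
    let ?D = "\<lambda>z. P z - ?G z"
    have D: "?D \<in> V \<mu> k" by (rule V_diff[OF P G])
    have "disc_inner \<mu> ?D ?D = 0"
      using o[OF D] orth[OF D] disc_inner_diff[OF f V_L2[OF P] V_L2[OF D]]
        disc_inner_diff[OF f V_L2[OF G] V_L2[OF D]] disc_inner_diff[OF V_L2[OF P] V_L2[OF G] V_L2[OF D]]
      by simp
    then have "?D = (\<lambda>_. 0)" by (rule disc_inner_self_eq_0[OF V_poly2[OF D]])
    then show ?case by (simp add: fun_eq_iff)
  qed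
qed

lemma proj_eq:
  assumes f: "f \<in> L2_disc \<mu>" and k: "k \<le> 2 * m"
  shows "proj \<mu> k f w = 1 / real (2 * m + 1) * (\<Sum>\<nu><2 * m + 1. (real k + \<mu> + 1/2) / (\<mu> + 1/2) *
    disc_inner \<mu> (ridge (gegenbauer (\<mu> + 1/2) k) (2 * pi * real \<nu> / real (2 * m + 1))) f *
    D_kernel \<mu> k (2 * pi * real \<nu> / real (2 * m + 1)) w)"
proof -
  define N where "N = 2 * m + 1"
  have N: "N > 0" by (simp add: N_def)
  let ?\<phi> = "\<lambda>\<nu>. 2 * pi * real \<nu> / real N"
  let ?c = "(real k + \<mu> + 1/2) / (\<mu> + 1/2)"
  \<comment> \<open>The factors are distributed so that the inner product of \<open>?A \<nu>\<close>
    with \<open>Q\<close> is exactly the value of \<open>Q\<close> at a node, and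
    \<open>?B \<nu>\<close> carries the reciprocal of the node count.\<close>
  let ?A = "\<lambda>\<nu> z. ?c * ridge (gegenbauer (\<mu> + 1/2) k) (?\<phi> \<nu>) z"
  let ?B = "\<lambda>\<nu> w. 1 / real N * D_kernel \<mu> k (?\<phi> \<nu>) w"
  have "proj \<mu> k f = (\<lambda>w. \<Sum>\<nu><N. disc_inner \<mu> (?A \<nu>) f * ?B \<nu> w)"
  proof (rule proj_eq_finite_kernel[OF f])
    fix Q w assume Q: "Q \<in> V \<mu> k"
    have "disc_inner \<mu> (?A \<nu>) Q = Q (cos (?\<phi> \<nu>), sin (?\<phi> \<nu>))" for \<nu>
      unfolding disc_inner_scale by (rule gegenbauer_ridge_reproducing[OF Q])
    then have "(\<Sum>\<nu><N. disc_inner \<mu> (?A \<nu>) Q * ?B \<nu> w) =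
      1 / real N * (\<Sum>\<nu><N. Q (cos (?\<phi> \<nu>), sin (?\<phi> \<nu>)) * D_kernel \<mu> k (?\<phi> \<nu>) w)"
      by (simp add: sum_distrib_left)
    also have "\<dots> = Q w" using discrete_reproducing[OF k Q, of w] N by (simp only: N_def[symmetric]) simp
    finally show "(\<Sum>\<nu><N. disc_inner \<mu> (?A \<nu>) Q * ?B \<nu> w) = Q w" .
  qed (simp_all only: finite_lessThan V_scale gegenbauer_ridge_V D_kernel_V)
  then show ?thesis
    unfolding N_def[symmetric] disc_inner_scale by (simp add: sum_distrib_left mult_ac)
qed

section \<open>Radon projections tested against polynomials\<close>

lemma radon_ridge:
  assumes "f \<in> L2_disc \<mu>"
  shows "a_const \<mu> * (LINT t:{-1..1}|lebesgue. radon \<mu> \<xi> f t * poly g t) = disc_inner \<mu> (ridge g \<xi>) f"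
proof -
  have "set_integrable lebesgue B2 (\<lambda>z. f z * ridge g \<xi> z * W \<mu> z)"
    using assms poly2_L2[OF poly2_le_ridge[OF order.refl]] by (rule L2_mult_integrable)
  then have "(LINT t:{-1..1}|lebesgue. radon \<mu> \<xi> f t * poly g t) = (LINT z:B2|lebesgue. f z * ridge g \<xi> z * W \<mu> z)"
    unfolding ridge_def by (rule radon_integral)
  then show ?thesis by (simp add: disc_inner_def mult.commute)
qed

text \<open>With \<xi> and \<open>w\<close> fixed, \<open>Phi\<close> is a single polynomial
  \<open>g\<close> in \<open>t\<close>. Slicing is therefore applied once, and the sum over
  \<open>k\<close> is split only on the disc, where integrability is at hand.\<close>

lemma radon_Phi:
  assumes f: "f \<in> L2_disc \<mu>"
  shows "a_const \<mu> * (LINT t:{-1..1}|lebesgue. radon \<mu> \<xi> f t * Phi \<mu> n \<xi> t w) =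
    (\<Sum>k\<le>n. (real k + \<mu> + 1/2) / (\<mu> + 1/2) * disc_inner \<mu> (ridge (gegenbauer (\<mu> + 1/2) k) \<xi>) f * D_kernel \<mu> k \<xi> w)"
proof -
  let ?c = "\<lambda>k. (real k + \<mu> + 1/2) / (\<mu> + 1/2) * D_kernel \<mu> k \<xi> w"
  define g where "g = (\<Sum>k\<le>n. smult (?c k) (gegenbauer (\<mu> + 1/2) k))"
  have "Phi \<mu> n \<xi> t w = poly g t" for t
    unfolding Phi_def g_def poly_sum by (intro sum.cong refl) simp
  then have "a_const \<mu> * (LINT t:{-1..1}|lebesgue. radon \<mu> \<xi> f t * Phi \<mu> n \<xi> t w) = disc_inner \<mu> (ridge g \<xi>) f"
    using radon_ridge[OF f, of \<xi> g] by simp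
  also have "ridge g \<xi> = (\<lambda>z. \<Sum>k\<le>n. ?c k * ridge (gegenbauer (\<mu> + 1/2) k) \<xi> z)"
    by (simp add: fun_eq_iff ridge_def g_def poly_sum)
  also have "disc_inner \<mu> \<dots> f = (\<Sum>k\<le>n. ?c k * disc_inner \<mu> (ridge (gegenbauer (\<mu> + 1/2) k) \<xi>) f)"
    using V_L2[OF gegenbauer_ridge_V] by (intro disc_inner_sum[OF f]) auto
  finally show ?thesis by (simp add: mult_ac)
qed

end

theorem corollary2p11:
  fixes \<mu> :: real and m :: nat and f :: "real \<times> real \<Rightarrow> real" and x y :: real
  assumes "\<mu> \<ge> 0"
    and "f \<in> L2_disc \<mu>"
    and "(x, y) \<in> B2"
  shows "partial_sum \<mu> (2 * m) f (x, y) =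
    1 / real (2 * m + 1) *
      (\<Sum>\<nu>\<in>{0..2 * m}.
         let \<phi>\<^sub>\<nu> = 2 * real \<nu> * pi / real (2 * m + 1)
         in a_const \<mu> *
            (LINT t:{-1..1}|lebesgue. radon \<mu> \<phi>\<^sub>\<nu> f t * Phi \<mu> (2 * m) \<phi>\<^sub>\<nu> t (x, y)))"
proof -
  interpret disc_weight \<mu> by unfold_locales fact
  let ?\<phi> = "\<lambda>\<nu>. 2 * pi * real \<nu> / real (2 * m + 1)"
  let ?t = "\<lambda>k \<nu>. (real k + \<mu> + 1/2) / (\<mu> + 1/2) *
    disc_inner \<mu> (ridge (gegenbauer (\<mu> + 1/2) k) (?\<phi> \<nu>)) f * D_kernel \<mu> k (?\<phi> \<nu>) (x, y)"
  \<comment> \<open>All degrees up to \<open>2 * m\<close> share the same nodes, so the sum over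
    \<open>k\<close> can be moved inside and collected into \<open>Phi\<close>.\<close>
  have "partial_sum \<mu> (2 * m) f (x, y) = (\<Sum>k\<le>2 * m. 1 / real (2 * m + 1) * (\<Sum>\<nu><2 * m + 1. ?t k \<nu>))"
    unfolding partial_sum_def by (intro sum.cong refl proj_eq[OF assms(2)]) simp
  also have "\<dots> = 1 / real (2 * m + 1) * (\<Sum>\<nu><2 * m + 1. \<Sum>k\<le>2 * m. ?t k \<nu>)"
    unfolding sum_distrib_left[symmetric] by (subst sum.swap) (rule refl)
  also have "{..<2 * m + 1} = {0..2 * m}" by auto
  finally show ?thesis
    unfolding Let_def radon_Phi[OF assms(2)] by (simp only: mult.commute[of _ pi] mult.assoc mult.left_commute[of _ pi])
qed

end
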